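(* Let $\Omega=(0,1)^2$, $1\le p,q\le2$, $\nu_1,\nu_2>0$, $f\in L_2(\Omega)$, $n\in\mathbb N$. Let $\psi_1,\dots,\psi_J$ be tensor-product B-spline framelets with associated differential operators $D_1,\dots,D_J$ of orders $s_j\ge1$, $s=\max_js_j$, and let $\mathbf A_n$ be a linear operator on $\mathbb R^{|\mathbf K_n|}$. For $\mathbf u_n\in\mathbb R^{|\mathbf K_n|}$ and $\mathbf v_n\in\mathbb R^{J|\mathbf K_n|}$ let $$F_n(\mathbf u_n,\mathbf v_n)=\nu_1\|\mathbf W_n'\mathbf u_n-\mathbf v_n\|^p_{\ell_p(\mathbf K_n;\ell_2(\mathbb R^J))}+\nu_2\|\mathbf W_n''\mathbf v_n\|^q_{\ell_q(\mathbf K_n;\ell_2(\mathbb R^{J^2}))}+\tfrac12\|\mathbf A_n\mathbf u_n-\mathbf f_n\|^2_{\ell_2(\mathbf K_n)},\qquad \mathbf f_n=\mathbf T_nf,$$ and for $u\in W_{2s}^p(\Omega)$, $v\in W_s^q(\Omega;\mathbb R^J)$ let $E_n(u,v)=F_n(\mathbf T_nu,\mathbf S_nv)$. Then for any given $\mathbf u_n\in\mathbb R^{|\mathbf K_n|}$, $\mathbf v_n\in\mathbb R^{J|\mathbf K_n|}$ there exist $u\in W_{2s}^p(\Omega)$ and $v\in W_s^q(\Omega;\mathbb R^J)$ such that $E_n(u,v)=F_n(\mathbf u_n,\mathbf v_n)$. Conversely, for any $u\in W_{2s}^p(\Omega)$ and $v\in W_s^q(\Omega;\mathbb R^J)$ there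 exist $\mathbf u_n,\mathbf v_n$ such that $E_n(u,v)=F_n(\mathbf u_n,\mathbf v_n)$. In particular, $$\inf_{\mathbf u_n\in\mathbb R^{|\mathbf K_n|},\,\mathbf v_n\in\mathbb R^{J|\mathbf K_n|}}F_n(\mathbf u_n,\mathbf v_n)=\inf_{u\in W_{2s}^p(\Omega),\,v\in W_s^q(\Omega;\mathbb R^J)}E_n(u,v).$$
   Context: **Spaces.** $W_r^p(\Omega)$ is the Sobolev space of functions with weak derivatives up to order $r$ in $L_p(\Omega)$; $W_r^q(\Omega;\mathbb R^J)$ is its $\mathbb R^J$-valued version. For an $\mathbb R^M$-valued array $\mathbf a$ on a finite index set $\mathbf K_n$ (below), $\|\mathbf a\|_{\ell_p(\mathbf K_n;\ell_2(\mathbb R^M))}=\big(2^{-2n}\sum_{\mathbf k\in\mathbf K_n}|\mathbf a[\mathbf k]|_2^p\big)^{1/p}$ with $|\cdot|_2$ the Euclidean norm; $\ell_2(\mathbf K_n)$ is the case $M=1$, $p=2$. $\mathbb R^{|\mathbf K_n|}$ and $\mathbb R^{J|\mathbf K_n|}$ denote the real-valued and $\mathbb R^J$-valued arrays on $\mathbf K_n$. **B-spline framelets.** For an integer $m\ge1$ let $\kappa\in\{0,1\}$ have the parity of $m$, let $B_m$ be the B-spline with $\widehat B_m(\omega)=e^{-i\kappa\omega/2}\big(\tfrac{\sin(\omega/2)}{\omega/2}\big)^m$, and for $0\le r\le m$ let $q_r$ be the finite real filter with $\sum_kq_r[k]e^{-ik\omega}=i^r\sqrt{\tbinom mr}\,e^{-i\kappa\omega/2}\cos^{m-r}(\omega/2)\sin^r(\omega/2)$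 (up to a sign, which is immaterial). Put $\phi=B_m\otimes B_m$, $\mathbf q^{(0)}=q_0\otimes q_0$. The framelets of the tensor-product B-spline tight wavelet frame system of order $m$ are $\psi=4\sum_{\mathbf k\in\mathbb Z^2}\mathbf q[\mathbf k]\phi(2\cdot-\mathbf k)$ with $\mathbf q=q_{r_1}\otimes q_{r_2}$, $(r_1,r_2)\ne(0,0)$, $0\le r_1,r_2\le m$; the differential operator associated with such $\psi$ is $\partial_1^{r_1}\partial_2^{r_2}$. Given framelets $\psi_1,\dots,\psi_J$ (of one fixed order $m$) with filters $\mathbf q^{(1)},\dots,\mathbf q^{(J)}$ and associated operators $D_1,\dots,D_J$ of orders $s_1,\dots,s_J$: - $\varphi_j$ is the compactly supported function with $D_j\varphi_j=\psi_j$; $c_j=\int\varphi_j\neq0$. - $\varphi_{ij}$ is the compactly supported function with $D_i\varphi_{ij}=4c_j^{-1}\sum_{\mathbf m\in\mathbb Z^2}\mathbf q^{(i)}[\mathbf m]\,\varphi_j(2\cdot-\mathbf m/2)$; $c_{ij}=\int\varphi_{ij}\ne0$. - $\phi_{n,\mathbf k}=2^n\phi(2^n\cdot-\mathbf k)$, $\varphi_{j,n-1,\mathbf k}=2^{n-2}\varphi_j(2^{n-1}\cdot-\mathbf k/2)$. **Index sets.** $\mathbf M_n=\{\mathbf k\in\mathbb Z^2:\operatorname{supp}\phi_{n,\mathbf k}\subset\overline\Omega\}$ and $\mathbf K_n=\{\mathbf k\in\mathbf M_n:\mathbf k+C\cdot\operatorname{supp}(\mathbf q^{(j)})\subset\mathbf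 M_n\text{ for all }0\le j\le J\}$, where $C$ is a fixed positive integer large enough that for $\mathbf k\in\mathbf K_n$ the functions $\phi_{n,\mathbf k}$ and $\varphi_{j,n-1,\mathbf k}$, $1\le j\le J$, are supported in $\overline\Omega$. **Sampling.** For $\mathbf k\in\mathbf K_n$: $(\mathbf T_ng)[\mathbf k]=2^n\langle g,\phi_{n,\mathbf k}\rangle_{L_2(\Omega)}$ for $g\in L_2(\Omega)$, and $(\mathbf S_nv)[j;\mathbf k]=2^n\langle v_j,c_j^{-1}\varphi_{j,n-1,\mathbf k}\rangle_{L_2(\Omega)}$ for $v\in L_2(\Omega;\mathbb R^J)$. **Weighted transforms.** $\mathbf W_n':\mathbb R^{|\mathbf K_n|}\to\mathbb R^{J|\mathbf K_n|}$ and $\mathbf W_n'':\mathbb R^{J|\mathbf K_n|}\to\mathbb R^{J^2|\mathbf K_n|}$ are $$(\mathbf W_n'\mathbf u)[j;\mathbf k]=c_j^{-1}(-1)^{s_j}2^{(n-1)s_j}\sum_{\mathbf l}\mathbf q^{(j)}[\mathbf l-\mathbf k]\mathbf u[\mathbf l],\qquad(\mathbf W_n''\mathbf v)[i,j;\mathbf k]=c_{ij}^{-1}(-1)^{s_i}2^{(n-2)s_i}\sum_{\mathbf l}\mathbf q^{(i)}[\mathbf l-\mathbf k]\mathbf v[j;\mathbf l],$$ for $1\le i,j\le J$ and $\mathbf k\in\mathbf K_n$, where values of arrays at indices outside $\mathbf K_n$ are supplied by some fixed linear boundary condition (for example periodic). *)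

theory Defs
  imports "HOL-Analysis.Analysis" "HOL-Probability.Probability"
begin

section \<open>Supports, test functions, weak derivatives and Sobolev spaces\<close>

text \<open>Functions on the plane are Borel representatives of classes modulo equality almost
  everywhere; hence the support is the essential one, which agrees with the closure of the
  set where the function is nonzero if the function is continuous.\<close>

definition ess_supp :: "('a::euclidean_space \<Rightarrow> real) \<Rightarrow> 'a set" where
  "ess_supp f = {x. \<forall>U. open U \<and> x \<in> U \<longrightarrow> \<not> (AE y in lborel. y \<in> U \<longrightarrow> f y = 0)}"

definition dir_deriv :: "real \<times> real \<Rightarrow> (real \<times> real \<Rightarrow> real) \<Rightarrow> real \<times> real \<Rightarrow> real" where
  "dir_deriv e g = (\<lambda>x. frechet_derivative g (at x) e)"

fun C_class :: "nat \<Rightarrow> (real \<times> real \<Rightarrow> real) \<Rightarrow> bool" where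
  "C_class 0 g \<longleftrightarrow> continuous_on UNIV g"
| "C_class (Suc r) g \<longleftrightarrow> (\<forall>x. g differentiable (at x)) \<and>
     C_class r (dir_deriv (1, 0) g) \<and> C_class r (dir_deriv (0, 1) g)"

definition partial_deriv :: "nat \<times> nat \<Rightarrow> (real \<times> real \<Rightarrow> real) \<Rightarrow> real \<times> real \<Rightarrow> real" where
  "partial_deriv \<alpha> g = (dir_deriv (1, 0) ^^ fst \<alpha>) ((dir_deriv (0, 1) ^^ snd \<alpha>) g)"

definition test_function :: "(real \<times> real) set \<Rightarrow> (real \<times> real \<Rightarrow> real) \<Rightarrow> bool" where
  "test_function U \<zeta> \<longleftrightarrow> (\<forall>r. C_class r \<zeta>) \<and>
     (\<exists>K. compact K \<and> K \<subseteq> U \<and> (\<forall>x. x \<notin> K \<longrightarrow> \<zeta> x = 0))"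

definition locally_integrable :: "(real \<times> real) set \<Rightarrow> (real \<times> real \<Rightarrow> real) \<Rightarrow> bool" where
  "locally_integrable U f \<longleftrightarrow> (\<forall>K. compact K \<and> K \<subseteq> U \<longrightarrow> set_integrable lborel K f)"

definition has_weak_deriv ::
  "(real \<times> real) set \<Rightarrow> nat \<times> nat \<Rightarrow> (real \<times> real \<Rightarrow> real) \<Rightarrow> (real \<times> real \<Rightarrow> real) \<Rightarrow> bool" where
  "has_weak_deriv U \<alpha> f g \<longleftrightarrow> locally_integrable U f \<and> locally_integrable U g \<and>
     (\<forall>\<zeta>. test_function U \<zeta> \<longrightarrow>
        (LINT x:U|lborel. f x * partial_deriv \<alpha> \<zeta> x)
        = (-1) ^ (fst \<alpha> + snd \<alpha>) * (LINT x:U|lborel. g x * \<zeta> x))"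

definition Lp_on :: "real \<Rightarrow> (real \<times> real) set \<Rightarrow> (real \<times> real \<Rightarrow> real) set" where
  "Lp_on p U = {f. set_borel_measurable lborel U f \<and>
                   set_integrable lborel U (\<lambda>x. \<bar>f x\<bar> powr p)}"

definition sobolev :: "nat \<Rightarrow> real \<Rightarrow> (real \<times> real) set \<Rightarrow> (real \<times> real \<Rightarrow> real) set" where
  "sobolev r p U = {f. f \<in> Lp_on p U \<and>
     (\<forall>\<alpha>. fst \<alpha> + snd \<alpha> \<le> r \<longrightarrow> (\<exists>g \<in> Lp_on p U. has_weak_deriv U \<alpha> f g))}"

text \<open>The \<open>\<real>\<^sup>J\<close>-valued version; the components are indexed by \<open>1, \<dots>, J\<close>.\<close>

definition sobolev_vec ::
  "nat \<Rightarrow> nat \<Rightarrow> real \<Rightarrow> (real \<times> real) set \<Rightarrow> (nat \<Rightarrow> real \<times> real \<Rightarrow> real) set" where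
  "sobolev_vec J r q U = {v. \<forall>j\<in>{1..J}. v j \<in> sobolev r q U}"

definition unit_square :: "(real \<times> real) set" where
  "unit_square = {0<..<1} \<times> {0<..<1}"


section \<open>Arrays\<close>

abbreviation arrays :: "'a set \<Rightarrow> ('a \<Rightarrow> real) set" where
  "arrays I \<equiv> I \<rightarrow>\<^sub>E UNIV"

definition array_linear :: "'a set \<Rightarrow> 'b set \<Rightarrow> (('a \<Rightarrow> real) \<Rightarrow> 'b \<Rightarrow> real) \<Rightarrow> bool" where
  "array_linear I I' L \<longleftrightarrow> (\<forall>u \<in> arrays I. L u \<in> arrays I') \<and>
     (\<forall>u \<in> arrays I. \<forall>v \<in> arrays I. \<forall>a b. \<forall>k \<in> I'.
        L (\<lambda>l\<in>I. a * u l + b * v l) k = a * L u k + b * L v k)"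

text \<open>Extension of arrays on \<open>K\<close> to all of \<open>\<int>\<^sup>2\<close> by a linear boundary condition.\<close>

definition boundary_extension ::
  "(int \<times> int) set \<Rightarrow> ((int \<times> int \<Rightarrow> real) \<Rightarrow> int \<times> int \<Rightarrow> real) \<Rightarrow> bool" where
  "boundary_extension K bc \<longleftrightarrow> array_linear K UNIV bc \<and> (\<forall>u \<in> arrays K. \<forall>k \<in> K. bc u k = u k)"

text \<open>The norm of \<open>\<ell>\<^sub>p(K; \<ell>\<^sub>2(\<real>\<^sup>Q))\<close> at level \<open>n\<close>, where the array is indexed by \<open>Q \<times> K\<close>.\<close>

definition array_norm ::
  "nat \<Rightarrow> real \<Rightarrow> 'a set \<Rightarrow> (int \<times> int) set \<Rightarrow> ('a \<times> (int \<times> int) \<Rightarrow> real) \<Rightarrow> real" where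
  "array_norm n p Q K a =
     ((1 / 2) ^ (2 * n) * (\<Sum>k\<in>K. (L2_set (\<lambda>j. a (j, k)) Q) powr p)) powr (1 / p)"

definition scalar_array_norm ::
  "nat \<Rightarrow> real \<Rightarrow> (int \<times> int) set \<Rightarrow> (int \<times> int \<Rightarrow> real) \<Rightarrow> real" where
  "scalar_array_norm n p K a = array_norm n p {()} K (\<lambda>(_, k). a k)"


section \<open>B-splines, their filters, and framelet systems\<close>

definition is_bspline :: "nat \<Rightarrow> (real \<Rightarrow> real) \<Rightarrow> bool" where
  "is_bspline m B \<longleftrightarrow> integrable lborel B \<and>
     (\<forall>\<omega>. (LINT x|lborel. complex_of_real (B x) * cis (- (\<omega> * x)))
        = cis (- (real (m mod 2) * \<omega> / 2)) * complex_of_real (sinc (\<omega> / 2) ^ m))"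

definition fsupp :: "('a \<Rightarrow> real) \<Rightarrow> 'a set" where
  "fsupp h = {k. h k \<noteq> 0}"

text \<open>The filter is determined up to the sign \<open>\<epsilon>\<close>.\<close>

definition is_bspline_filter :: "nat \<Rightarrow> nat \<Rightarrow> (int \<Rightarrow> real) \<Rightarrow> bool" where
  "is_bspline_filter m r h \<longleftrightarrow> finite (fsupp h) \<and>
     (\<exists>\<epsilon> \<in> {1, -1 :: real}. \<forall>\<omega>::real.
        (\<Sum>k\<in>fsupp h. complex_of_real (h k) * cis (- (real_of_int k * \<omega>)))
        = complex_of_real \<epsilon> * \<i> ^ r * complex_of_real (sqrt (real (m choose r)))
          * cis (- (real (m mod 2) * \<omega> / 2))
          * complex_of_real (cos (\<omega> / 2) ^ (m - r) * sin (\<omega> / 2) ^ r))"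

definition tensor :: "('a \<Rightarrow> real) \<Rightarrow> ('b \<Rightarrow> real) \<Rightarrow> 'a \<times> 'b \<Rightarrow> real" where
  "tensor f g = (\<lambda>(x, y). f x * g y)"

definition lattice_pt :: "int \<times> int \<Rightarrow> real \<times> real" where
  "lattice_pt k = (real_of_int (fst k), real_of_int (snd k))"

text \<open>\<open>exps j = (r\<^sub>1, r\<^sub>2)\<close> says that \<open>\<psi>\<^sub>j\<close> has the filter \<open>q\<^bsub>r\<^sub>1\<^esub> \<otimes> q\<^bsub>r\<^sub>2\<^esub>\<close>, so that
  \<open>D\<^sub>j = \<partial>\<^sub>1\<^bsup>r\<^sub>1\<^esup> \<partial>\<^sub>2\<^bsup>r\<^sub>2\<^esup>\<close>; \<open>prim j\<close> is the compactly supported solution of \<open>D\<^sub>j g = \<psi>\<^sub>j\<close>, and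
  \<open>prim2 i j\<close> is the analogous second-level function for \<open>D\<^sub>i\<close>. Only the indices in \<open>{1..num}\<close>
  matter.\<close>

record framelet_system =
  spline_ord :: nat
  num :: nat
  spline :: "real \<Rightarrow> real"
  filt :: "nat \<Rightarrow> int \<Rightarrow> real"
  exps :: "nat \<Rightarrow> nat \<times> nat"
  prim :: "nat \<Rightarrow> real \<times> real \<Rightarrow> real"
  prim2 :: "nat \<Rightarrow> nat \<Rightarrow> real \<times> real \<Rightarrow> real"

definition scaling_fn :: "framelet_system \<Rightarrow> real \<times> real \<Rightarrow> real" where
  "scaling_fn S = tensor (spline S) (spline S)"

text \<open>\<open>\<^bold>q\<^sup>(\<^sup>j\<^sup>)\<close> for \<open>0 \<le> j \<le> J\<close>.\<close>

definition qfilt :: "framelet_system \<Rightarrow> nat \<Rightarrow> int \<times> int \<Rightarrow> real" where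
  "qfilt S j = (if j = 0 then tensor (filt S 0) (filt S 0)
                else tensor (filt S (fst (exps S j))) (filt S (snd (exps S j))))"

definition framelet :: "framelet_system \<Rightarrow> nat \<Rightarrow> real \<times> real \<Rightarrow> real" where
  "framelet S j = (\<lambda>x. 4 * (\<Sum>k\<in>fsupp (qfilt S j).
     qfilt S j k * scaling_fn S (2 *\<^sub>R x - lattice_pt k)))"

definition diff_ord :: "framelet_system \<Rightarrow> nat \<Rightarrow> nat" where
  "diff_ord S j = fst (exps S j) + snd (exps S j)"

definition max_ord :: "framelet_system \<Rightarrow> nat" where
  "max_ord S = Max (diff_ord S ` {1..num S})"

definition cst :: "framelet_system \<Rightarrow> nat \<Rightarrow> real" where
  "cst S j = (LINT x|lborel. prim S j x)"

definition cst2 :: "framelet_system \<Rightarrow> nat \<Rightarrow> nat \<Rightarrow> real" where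
  "cst2 S i j = (LINT x|lborel. prim2 S i j x)"

definition is_framelet_system :: "framelet_system \<Rightarrow> bool" where
  "is_framelet_system S \<longleftrightarrow>
     1 \<le> spline_ord S \<and> 1 \<le> num S \<and>
     is_bspline (spline_ord S) (spline S) \<and>
     (\<forall>r \<le> spline_ord S. is_bspline_filter (spline_ord S) r (filt S r)) \<and>
     (\<forall>j\<in>{1..num S}. exps S j \<noteq> (0, 0) \<and>
        fst (exps S j) \<le> spline_ord S \<and> snd (exps S j) \<le> spline_ord S) \<and>
     (\<forall>j\<in>{1..num S}. compact (ess_supp (prim S j)) \<and>
        has_weak_deriv UNIV (exps S j) (prim S j) (framelet S j)) \<and>
     (\<forall>i\<in>{1..num S}. \<forall>j\<in>{1..num S}. compact (ess_supp (prim2 S i j)) \<and>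
        has_weak_deriv UNIV (exps S i) (prim2 S i j)
          (\<lambda>x. 4 * inverse (cst S j) * (\<Sum>k\<in>fsupp (qfilt S i).
             qfilt S i k * prim S j (2 *\<^sub>R x - (1 / 2) *\<^sub>R lattice_pt k))))"


section \<open>Index sets, sampling and weighted transforms\<close>

definition scaled_phi :: "framelet_system \<Rightarrow> nat \<Rightarrow> int \<times> int \<Rightarrow> real \<times> real \<Rightarrow> real" where
  "scaled_phi S n k = (\<lambda>x. 2 ^ n * scaling_fn S (2 ^ n *\<^sub>R x - lattice_pt k))"

text \<open>\<open>scaled_prim S j n k\<close> lives at level \<open>n - 1\<close>; the exponents can be negative, hence \<open>powi\<close>.\<close>

definition scaled_prim :: "framelet_system \<Rightarrow> nat \<Rightarrow> nat \<Rightarrow> int \<times> int \<Rightarrow> real \<times> real \<Rightarrow> real" where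
  "scaled_prim S j n k = (\<lambda>x. 2 powi (int n - 2) *
     prim S j (2 powi (int n - 1) *\<^sub>R x - (1 / 2) *\<^sub>R lattice_pt k))"

definition Mset :: "framelet_system \<Rightarrow> nat \<Rightarrow> (int \<times> int) set" where
  "Mset S n = {k. ess_supp (scaled_phi S n k) \<subseteq> closure unit_square}"

definition Kset :: "framelet_system \<Rightarrow> int \<Rightarrow> nat \<Rightarrow> (int \<times> int) set" where
  "Kset S C n = {k \<in> Mset S n. \<forall>j\<in>{0..num S}.
     (\<lambda>l. (fst k + C * fst l, snd k + C * snd l)) ` fsupp (qfilt S j) \<subseteq> Mset S n}"

definition large_enough :: "framelet_system \<Rightarrow> int \<Rightarrow> nat \<Rightarrow> bool" where
  "large_enough S C n \<longleftrightarrow> (\<forall>k \<in> Kset S C n.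
     ess_supp (scaled_phi S n k) \<subseteq> closure unit_square \<and>
     (\<forall>j\<in>{1..num S}. ess_supp (scaled_prim S j n k) \<subseteq> closure unit_square))"

definition sampleT ::
  "framelet_system \<Rightarrow> int \<Rightarrow> nat \<Rightarrow> (real \<times> real \<Rightarrow> real) \<Rightarrow> int \<times> int \<Rightarrow> real" where
  "sampleT S C n g = (\<lambda>k\<in>Kset S C n.
     2 ^ n * (LINT x:unit_square|lborel. g x * scaled_phi S n k x))"

definition sampleS ::
  "framelet_system \<Rightarrow> int \<Rightarrow> nat \<Rightarrow> (nat \<Rightarrow> real \<times> real \<Rightarrow> real) \<Rightarrow> nat \<times> (int \<times> int) \<Rightarrow> real" where
  "sampleS S C n v = (\<lambda>(j, k)\<in>{1..num S} \<times> Kset S C n.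
     2 ^ n * (LINT x:unit_square|lborel. v j x * (inverse (cst S j) * scaled_prim S j n k x)))"

text \<open>\<open>corr h u k = \<Sum>\<^sub>l h[l - k] u[l]\<close>; the sum is over \<open>\<int>\<^sup>2\<close>, restricted to the nonzero filter taps.\<close>

definition corr :: "(int \<times> int \<Rightarrow> real) \<Rightarrow> (int \<times> int \<Rightarrow> real) \<Rightarrow> int \<times> int \<Rightarrow> real" where
  "corr h u k = (\<Sum>l\<in>{l. h (l - k) \<noteq> 0}. h (l - k) * u l)"

definition W1 ::
  "framelet_system \<Rightarrow> int \<Rightarrow> nat \<Rightarrow> ((int \<times> int \<Rightarrow> real) \<Rightarrow> int \<times> int \<Rightarrow> real)
     \<Rightarrow> (int \<times> int \<Rightarrow> real) \<Rightarrow> nat \<times> (int \<times> int) \<Rightarrow> real" where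
  "W1 S C n bc u = (\<lambda>(j, k)\<in>{1..num S} \<times> Kset S C n.
     inverse (cst S j) * (-1) ^ diff_ord S j * 2 powi ((int n - 1) * int (diff_ord S j))
     * corr (qfilt S j) (bc u) k)"

definition W2 ::
  "framelet_system \<Rightarrow> int \<Rightarrow> nat \<Rightarrow> ((int \<times> int \<Rightarrow> real) \<Rightarrow> int \<times> int \<Rightarrow> real)
     \<Rightarrow> (nat \<times> (int \<times> int) \<Rightarrow> real) \<Rightarrow> (nat \<times> nat) \<times> (int \<times> int) \<Rightarrow> real" where
  "W2 S C n bc v = (\<lambda>((i, j), k)\<in>({1..num S} \<times> {1..num S}) \<times> Kset S C n.
     inverse (cst2 S i j) * (-1) ^ diff_ord S i * 2 powi ((int n - 2) * int (diff_ord S i))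
     * corr (qfilt S i) (bc (\<lambda>l\<in>Kset S C n. v (j, l))) k)"


section \<open>The discrete and the continuum functionals\<close>

definition F_energy ::
  "framelet_system \<Rightarrow> int \<Rightarrow> nat \<Rightarrow> ((int \<times> int \<Rightarrow> real) \<Rightarrow> int \<times> int \<Rightarrow> real)
     \<Rightarrow> ((int \<times> int \<Rightarrow> real) \<Rightarrow> int \<times> int \<Rightarrow> real) \<Rightarrow> real \<Rightarrow> real \<Rightarrow> real \<Rightarrow> real
     \<Rightarrow> (real \<times> real \<Rightarrow> real) \<Rightarrow> (int \<times> int \<Rightarrow> real) \<Rightarrow> (nat \<times> (int \<times> int) \<Rightarrow> real) \<Rightarrow> real" where
  "F_energy S C n bc A p q \<nu>\<^sub>1 \<nu>\<^sub>2 f u v =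
     \<nu>\<^sub>1 * array_norm n p {1..num S} (Kset S C n) (\<lambda>i. W1 S C n bc u i - v i) powr p
     + \<nu>\<^sub>2 * array_norm n q ({1..num S} \<times> {1..num S}) (Kset S C n) (W2 S C n bc v) powr q
     + 1 / 2 * (scalar_array_norm n 2 (Kset S C n) (\<lambda>k. A u k - sampleT S C n f k))\<^sup>2"

definition E_energy ::
  "framelet_system \<Rightarrow> int \<Rightarrow> nat \<Rightarrow> ((int \<times> int \<Rightarrow> real) \<Rightarrow> int \<times> int \<Rightarrow> real)
     \<Rightarrow> ((int \<times> int \<Rightarrow> real) \<Rightarrow> int \<times> int \<Rightarrow> real) \<Rightarrow> real \<Rightarrow> real \<Rightarrow> real \<Rightarrow> real
     \<Rightarrow> (real \<times> real \<Rightarrow> real) \<Rightarrow> (real \<times> real \<Rightarrow> real) \<Rightarrow> (nat \<Rightarrow> real \<times> real \<Rightarrow> real) \<Rightarrow> real" where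
  "E_energy S C n bc A p q \<nu>\<^sub>1 \<nu>\<^sub>2 f u v =
     F_energy S C n bc A p q \<nu>\<^sub>1 \<nu>\<^sub>2 f (sampleT S C n u) (sampleS S C n v)"

end

theory Submission
  imports Defs
begin

text \<open>Since \<open>E u v = F (T u) (S v)\<close>, everything follows once the sampling operators \<open>T\<close> and \<open>S\<close>
  are onto. Their sampling functions are finitely many translates of one compactly supported
  function that is not zero almost everywhere. Ordering the translates along a generic direction,
  each of them is alone among itself and its successors near an extreme point of its essential
  support, so testing with smooth functions concentrated there gives a triangular system; the
  resulting interpolant is smooth, hence in every Sobolev space. For \<open>S\<close> one also needs
  \<open>c\<^sub>j \<noteq> 0\<close>: the weak equation \<open>D\<^sub>j \<phi>\<^sub>j = \<psi>\<^sub>j\<close> tested with truncated cosines of frequency \<open>w\<close>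
  expresses the Fourier transform of \<open>\<phi>\<^sub>j\<close> through that of \<open>\<psi>\<^sub>j\<close>, whose zero at the origin has
  exactly the order of \<open>D\<^sub>j\<close>.\<close>

section \<open>Smooth functions of one variable\<close>

text \<open>The sampling functions are known only indirectly: the B-spline through its Fourier
  transform, each primitive through a weak differential equation and the compactness of its support.
  The interpolation argument therefore asks of the sampling function only integrability and a
  compact, nonempty essential support. Nonemptiness is deduced from a nonzero mean. For the
  primitives the same fact has a second use: \<open>is_framelet_system\<close> does not assert c_j
  \<noteq> 0, and since \<open>inverse 0 = 0\<close>, a vanishing mean would make a whole component
  of the sampling operator zero. Cosines are not test functions, which is why they must be
  truncated. On the side of \<phi>_j the cutoff disappears once it equals 1 on the compact support;
  on the side of \<psi>_j it is removed by dominated convergence. Using the diagonal frequency (w,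
  w) reduces the behaviour at the origin to a limit in one real variable.\<close>

fun C1_class :: "nat \<Rightarrow> (real \<Rightarrow> real) \<Rightarrow> bool" where
  "C1_class 0 a \<longleftrightarrow> continuous_on UNIV a"
| "C1_class (Suc r) a \<longleftrightarrow> (\<exists>a'. (\<forall>x. (a has_real_derivative a' x) (at x)) \<and> C1_class r a')"

text \<open>In \<open>C1_class\<close> the derivative is an existential witness and not
  \<open>deriv\<close>, so that each closure lemma can supply an explicit formula;
  \<open>C1_class_deriv\<close> leads back to \<open>deriv\<close>.\<close>

definition smooth1 :: "(real \<Rightarrow> real) \<Rightarrow> bool" where
  "smooth1 a \<longleftrightarrow> (\<forall>r. C1_class r a)"

lemma C1_class_SucI:
  "C1_class r a' \<Longrightarrow> (\<And>x. (a has_real_derivative a' x) (at x)) \<Longrightarrow> C1_class (Suc r) a"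
  by auto

lemma C1_class_continuous: "C1_class r a \<Longrightarrow> continuous_on UNIV a"
proof (cases r)
  case (Suc k)
  moreover assume "C1_class r a"
  ultimately obtain a' where "\<And>x. (a has_real_derivative a' x) (at x)" by auto
  then show ?thesis by (blast intro: continuous_at_imp_continuous_on DERIV_isCont)
qed simp

lemma C1_class_mono: "C1_class (Suc r) a \<Longrightarrow> C1_class r a"
proof (induction r arbitrary: a)
  case 0
  then show ?case using C1_class_continuous C1_class.simps(1) by blast
next
  case (Suc r)
  then show ?case by (metis C1_class.simps(2))
qed

lemma C1_class_add: "C1_class r a \<Longrightarrow> C1_class r b \<Longrightarrow> C1_class r (\<lambda>x. a x + b x)"
proof (induction r arbitrary: a b)
  case 0
  then show ?case by (auto intro: continuous_intros)
next
  case (Suc r)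
  then obtain a' b' where "\<And>x. (a has_real_derivative a' x) (at x)" "C1_class r a'"
    "\<And>x. (b has_real_derivative b' x) (at x)" "C1_class r b'" by auto
  then show ?case using Suc.IH[of a' b']
    by (auto intro!: exI[of _ "\<lambda>x. a' x + b' x"] DERIV_add)
qed

lemma C1_class_mult: "C1_class r a \<Longrightarrow> C1_class r b \<Longrightarrow> C1_class r (\<lambda>x. a x * b x)"
proof (induction r arbitrary: a b)
  case 0
  then show ?case by (auto intro: continuous_intros)
next
  case (Suc r)
  then obtain a' b' where *: "\<And>x. (a has_real_derivative a' x) (at x)" "C1_class r a'"
    "\<And>x. (b has_real_derivative b' x) (at x)" "C1_class r b'" by auto
  then have "C1_class r (\<lambda>x. a' x * b x + b' x * a x)"
    using Suc by (intro C1_class_add Suc.IH) (auto intro: C1_class_mono simp del: C1_class.simps)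
  then show ?case using *
    by (auto intro!: exI[of _ "\<lambda>x. a' x * b x + b' x * a x"] DERIV_mult)
qed

lemma C1_class_const: "C1_class r (\<lambda>x. c)"
proof (induction r arbitrary: c)
  case (Suc r)
  then show ?case by (auto intro!: exI[of _ "\<lambda>x. 0"] derivative_eq_intros)
qed auto

text \<open>The derivative of 1/a is -a'/a^2, which involves 1/a only up to the class that the
  induction hypothesis supplies.\<close>

lemma C1_class_inverse:
  assumes "C1_class r a" "\<And>x. a x \<noteq> 0"
  shows "C1_class r (\<lambda>x. inverse (a x))"
  using assms(1)
proof (induction r)
  case 0
  then show ?case using assms(2) by (auto intro: continuous_intros)
next
  case (Suc r)
  then obtain a' where a': "\<And>x. (a has_real_derivative a' x) (at x)" "C1_class r a'" by auto
  have "C1_class r (\<lambda>x. inverse (a x))"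
    using Suc by (auto intro: C1_class_mono simp del: C1_class.simps)
  then have "C1_class r (\<lambda>x. (-1) * (a' x * (inverse (a x) * inverse (a x))))"
    using a' by (intro C1_class_mult C1_class_const)
  then show ?case using a' assms(2)
    by (auto intro!: exI[of _ "\<lambda>x. (-1) * (a' x * (inverse (a x) * inverse (a x)))"]
        derivative_eq_intros simp: algebra_simps)
qed

lemma C1_class_affine: "C1_class r a \<Longrightarrow> C1_class r (\<lambda>x. a (c * x + d))"
proof (induction r arbitrary: a)
  case 0
  then show ?case
    by (auto intro!: continuous_intros intro: continuous_on_compose2[of UNIV a])
next
  case (Suc r)
  then obtain a' where a': "\<And>x. (a has_real_derivative a' x) (at x)" "C1_class r a'" by auto
  then have "C1_class r (\<lambda>x. c * a' (c * x + d))"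
    using Suc by (intro C1_class_mult C1_class_const) auto
  moreover have "((\<lambda>x. a (c * x + d)) has_real_derivative c * a' (c * x + d)) (at x)" for x
    by (rule DERIV_chain2[OF a'(1), THEN DERIV_cong])
       (auto intro!: derivative_eq_intros)
  ultimately show ?case by (rule C1_class_SucI)
qed

lemma smooth1_mult: "smooth1 a \<Longrightarrow> smooth1 b \<Longrightarrow> smooth1 (\<lambda>x. a x * b x)"
  and smooth1_affine: "smooth1 a \<Longrightarrow> smooth1 (\<lambda>x. a (c * x + d))"
  and smooth1_divide: "smooth1 a \<Longrightarrow> smooth1 b \<Longrightarrow> (\<And>x. b x \<noteq> 0) \<Longrightarrow> smooth1 (\<lambda>x. a x / b x)"
  and smooth1_add: "smooth1 a \<Longrightarrow> smooth1 b \<Longrightarrow> smooth1 (\<lambda>x. a x + b x)"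
  by (auto simp: smooth1_def divide_inverse
      intro!: C1_class_mult C1_class_affine C1_class_inverse C1_class_add)

lemma C1_class_deriv: "C1_class (Suc r) a \<Longrightarrow> C1_class r (deriv a)"
proof -
  assume "C1_class (Suc r) a"
  then obtain a' where a': "\<And>x. (a has_real_derivative a' x) (at x)" "C1_class r a'" by auto
  then have "deriv a = a'" by (auto intro: DERIV_imp_deriv)
  with a' show ?thesis by simp
qed

lemma smooth1_deriv: "smooth1 a \<Longrightarrow> smooth1 (deriv a)"
  unfolding smooth1_def using C1_class_deriv by blast

lemma smooth1_has_deriv: "smooth1 a \<Longrightarrow> (a has_real_derivative deriv a x) (at x)"
  unfolding smooth1_def
  by (metis C1_class.simps(2) DERIV_imp_deriv)

lemma smooth1_continuous: "smooth1 a \<Longrightarrow> continuous_on UNIV a"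
  unfolding smooth1_def using C1_class_continuous by blast

lemma smooth1_cos: "smooth1 (\<lambda>x. cos (w * x + t))"
proof -
  \<comment> \<open>Differentiation shifts the phase of a cosine by pi/2, so the induction closes
    when the phase is arbitrary. The frequency enters afterwards by an affine substitution.\<close>
  have "C1_class r (\<lambda>x. c * cos (x + t))" for r c t
  proof (induction r arbitrary: c t)
    case (Suc r)
    have "C1_class r (\<lambda>x. c * cos (x + (t + pi / 2)))" by (rule Suc)
    moreover have "((\<lambda>x. c * cos (x + t)) has_real_derivative c * cos (x + (t + pi / 2))) (at x)" for x
      by (auto intro!: derivative_eq_intros simp: cos_add[of "x + t" "pi/2"] simp flip: add.assoc)
    ultimately show ?case by (rule C1_class_SucI)
  qed (auto intro!: continuous_intros)
  from this[of _ 1 t] have "smooth1 (\<lambda>x. cos (x + t))" by (auto simp: smooth1_def)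
  from smooth1_affine[OF this, of w 0] show ?thesis by simp
qed

section \<open>The flat function exp(-1/x) and smooth cutoffs\<close>

text \<open>This family is closed under differentiation, which gives the smoothness of \<open>flat_exp\<close>.\<close>

definition exp_cutoff :: "real poly \<Rightarrow> real \<Rightarrow> real" where
  "exp_cutoff P x = (if x \<le> 0 then 0 else poly P (1 / x) * exp (- (1 / x)))"

lemma poly_times_exp_tendsto_0: "((\<lambda>t. poly P t * exp (- t)) \<longlongrightarrow> (0::real)) at_top"
proof -
  have "((\<lambda>t. \<Sum>i\<le>degree P. coeff P i * (t ^ i / exp t)) \<longlongrightarrow> (\<Sum>i\<le>degree P. coeff P i * (0::real))) at_top"
    by (intro tendsto_sum tendsto_mult tendsto_const tendsto_power_div_exp_0)
  then show ?thesis
    by (simp add: poly_altdef sum_distrib_right exp_minus divide_inverse mult.assoc)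
qed

lemma exp_cutoff_tendsto_0: "(exp_cutoff P \<longlongrightarrow> 0) (at 0)"
proof -
  have "((\<lambda>x. poly P (1 / x) * exp (- (1 / x))) \<longlongrightarrow> (0::real)) (at_right 0)"
    using filterlim_compose[OF poly_times_exp_tendsto_0 filterlim_inverse_at_top_right]
    by (simp add: divide_inverse)
  then have "(exp_cutoff P \<longlongrightarrow> 0) (at_right 0)"
    by (rule Lim_transform_eventually)
       (auto simp: exp_cutoff_def eventually_at_right_less intro: eventually_at_rightI[of 0 1])
  moreover have "(exp_cutoff P \<longlongrightarrow> 0) (at_left 0)"
    by (rule tendsto_eventually) (auto simp: exp_cutoff_def intro: eventually_at_leftI[of "-1" 0])
  ultimately show ?thesis by (simp add: filterlim_split_at)
qed

text \<open>With t = 1/x, differentiating P(t) exp(-t) in x gives t^2 (P(t) - P'(t)) exp(-t), which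
  is the origin of the polynomial on the right.\<close>

lemma exp_cutoff_has_deriv:
  "(exp_cutoff P has_real_derivative exp_cutoff ([:0, 0, 1:] * (P - pderiv P)) x) (at x)"
proof -
  consider "x < 0" | "x = 0" | "x > 0" by linarith
  then show ?thesis
  proof cases
    case 1
    have "((\<lambda>x. 0) has_real_derivative exp_cutoff ([:0, 0, 1:] * (P - pderiv P)) x) (at x)"
      using 1 by (simp add: exp_cutoff_def)
    then show ?thesis
      by (rule has_field_derivative_transform_within_open[where S = "{..<0}"])
         (use 1 in \<open>auto simp: exp_cutoff_def\<close>)
  next
    case 2
    \<comment> \<open>Division by the increment h is multiplication by t = 1/h, so the difference
      quotient at 0 is the cutoff function of the polynomial X P, that is
      \<open>pCons 0 P\<close>.\<close>
    have "(exp_cutoff (pCons 0 P) \<longlongrightarrow> 0) (at 0)" by (rule exp_cutoff_tendsto_0)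
    then have "((\<lambda>h. (exp_cutoff P (0 + h) - exp_cutoff P 0) / h) \<longlongrightarrow> 0) (at 0)"
      by (rule Lim_transform_eventually) (auto simp: exp_cutoff_def intro: always_eventually)
    moreover have "exp_cutoff Q 0 = 0" for Q by (simp add: exp_cutoff_def)
    ultimately show ?thesis by (simp only: 2 DERIV_def)
  next
    case 3
    have "((\<lambda>x. poly P (1 / x) * exp (- (1 / x))) has_real_derivative
        exp_cutoff ([:0, 0, 1:] * (P - pderiv P)) x) (at x)"
      using 3 by (auto intro!: derivative_eq_intros DERIV_chain2[of "poly P"] poly_DERIV
          simp: exp_cutoff_def field_simps power2_eq_square)
    then show ?thesis
      by (rule has_field_derivative_transform_within_open[where S = "{0<..}"])
         (use 3 in \<open>auto simp: exp_cutoff_def\<close>)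
  qed
qed

definition flat_exp :: "real \<Rightarrow> real" where
  "flat_exp x = (if x \<le> 0 then 0 else exp (- (1 / x)))"

lemma smooth1_flat_exp: "smooth1 flat_exp"
proof -
  have "C1_class r (exp_cutoff P)" for r P
  proof (induction r arbitrary: P)
    case 0
    then show ?case
      by (auto intro!: continuous_at_imp_continuous_on DERIV_isCont[OF exp_cutoff_has_deriv])
  next
    case (Suc r)
    then show ?case using exp_cutoff_has_deriv by auto
  qed
  moreover have "flat_exp = exp_cutoff 1"
    by (auto simp: flat_exp_def exp_cutoff_def fun_eq_iff)
  ultimately show ?thesis unfolding smooth1_def by metis
qed

text \<open>Here \<open>s\<close> is a smooth step, 0 for y \<le> 0 and 1 for y \<ge> 1; its
  denominator is positive because y and 1 - y are never both nonpositive. The product is a cutoff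
  that is 1 for \<bar>x\<bar> \<le> R and 0 for \<bar>x\<bar> \<ge> R + 1.\<close>

definition plateau :: "real \<Rightarrow> real \<Rightarrow> real" where
  "plateau R x = (let s = (\<lambda>y. flat_exp y / (flat_exp y + flat_exp (1 - y)))
                  in s (R + 1 + x) * s (R + 1 - x))"

lemma flat_exp_bounds: "0 \<le> flat_exp x" "flat_exp x \<le> 1" "0 < flat_exp x \<longleftrightarrow> 0 < x"
  by (auto simp: flat_exp_def)

lemma smooth1_plateau: "smooth1 (plateau R)"
proof -
  define s where "s y = flat_exp y / (flat_exp y + flat_exp (1 - y))" for y
  have "flat_exp y + flat_exp (1 - y) > 0" for y
    using flat_exp_bounds(1,3)[of y] flat_exp_bounds(1,3)[of "1 - y"]
    by (cases "y > 0") (auto intro: add_pos_nonneg add_nonneg_pos)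
  then have "smooth1 s" unfolding s_def
    using smooth1_affine[OF smooth1_flat_exp, of "-1" 1]
    by (intro smooth1_divide smooth1_add smooth1_flat_exp) (auto simp: less_imp_neq[symmetric] add.commute)
  from smooth1_mult[OF smooth1_affine[OF this, of 1 "R + 1"] smooth1_affine[OF this, of "-1" "R + 1"]]
  show ?thesis unfolding plateau_def Let_def s_def by (simp add: algebra_simps)
qed

lemma plateau_eq_1: "\<bar>x\<bar> \<le> R \<Longrightarrow> plateau R x = 1"
  and plateau_eq_0: "R + 1 \<le> \<bar>x\<bar> \<Longrightarrow> plateau R x = 0"
  by (auto simp: plateau_def Let_def flat_exp_def abs_if split: if_splits)

lemma plateau_bounds: "\<bar>plateau R x\<bar> \<le> 1"
proof -
  have "\<bar>flat_exp y / (flat_exp y + flat_exp (1 - y))\<bar> \<le> 1" for y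
    using flat_exp_bounds(1)[of y] flat_exp_bounds(1)[of "1 - y"]
    by (auto simp: divide_le_eq_1)
  then show ?thesis unfolding plateau_def Let_def abs_mult by (intro mult_le_one abs_ge_zero)
qed

section \<open>Smooth functions on the plane and weak derivatives\<close>

definition smooth2 :: "(real \<times> real \<Rightarrow> real) \<Rightarrow> bool" where
  "smooth2 g \<longleftrightarrow> (\<forall>r. C_class r g)"

lemma smooth2_differentiable: "smooth2 g \<Longrightarrow> g differentiable (at x)"
  and smooth2_dir_deriv: "smooth2 g \<Longrightarrow> e \<in> {(1, 0), (0, 1)} \<Longrightarrow> smooth2 (dir_deriv e g)"
  and smooth2_continuous: "smooth2 g \<Longrightarrow> continuous_on UNIV g"
  unfolding smooth2_def using C_class.simps by blast+

lemma smooth2_dir_deriv_funpow: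
  "smooth2 g \<Longrightarrow> e \<in> {(1, 0), (0, 1)} \<Longrightarrow> smooth2 ((dir_deriv e ^^ n) g)"
  by (induction n) (simp_all add: smooth2_dir_deriv)

lemma smooth2_has_derivative:
  "smooth2 g \<Longrightarrow> (g has_derivative frechet_derivative g (at x)) (at x)"
  by (simp flip: frechet_derivative_works add: smooth2_differentiable)

lemma dir_deriv_eqI: "(g has_derivative g') (at x) \<Longrightarrow> dir_deriv e g x = g' e"
  unfolding dir_deriv_def by (metis frechet_derivative_at)

lemma dir_deriv_lincomb:
  assumes "g differentiable (at x)" "h differentiable (at x)"
  shows "dir_deriv e (\<lambda>x. a * g x + b * h x) x = a * dir_deriv e g x + b * dir_deriv e h x"
proof -
  have "((\<lambda>x. a * g x + b * h x) has_derivative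
      (\<lambda>v. a * frechet_derivative g (at x) v + b * frechet_derivative h (at x) v)) (at x)"
    using assms by (auto intro!: derivative_intros simp flip: frechet_derivative_works)
  from dir_deriv_eqI[OF this] show ?thesis by (simp add: dir_deriv_def)
qed

lemma smooth2_lincomb:
  assumes "smooth2 g" "smooth2 h"
  shows "smooth2 (\<lambda>x. a * g x + b * h x)"
proof -
  have "C_class r g \<Longrightarrow> C_class r h \<Longrightarrow> C_class r (\<lambda>x. a * g x + b * h x)" for r
  proof (induction r arbitrary: g h)
    case 0
    then show ?case by (auto intro!: continuous_intros)
  next
    case (Suc r)
    then have d: "g differentiable (at x)" "h differentiable (at x)" for x
      by (simp_all only: C_class.simps)
    have "dir_deriv e (\<lambda>x. a * g x + b * h x) = (\<lambda>x. a * dir_deriv e g x + b * dir_deriv e h x)" for e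
      using dir_deriv_lincomb[OF d] by blast
    moreover have "(\<lambda>x. a * g x + b * h x) differentiable (at x)" for x
      using d by (intro derivative_intros)
    ultimately show ?case using Suc by (simp only: C_class.simps simp_thms)
  qed
  then show ?thesis using assms by (simp add: smooth2_def)
qed

text \<open>A partial derivative of a tensor product differentiates one factor and leaves the other
  alone, so tensor products are closed under both. Test functions with prescribed derivatives can
  thus be built from functions of one variable.\<close>

lemma C_class_tensor: "C1_class r a \<Longrightarrow> C1_class r b \<Longrightarrow> C_class r (tensor a b)"
  and dir_deriv_tensor: "smooth1 a \<Longrightarrow> smooth1 b \<Longrightarrow> dir_deriv (1, 0) (tensor a b) = tensor (deriv a) b"
    "smooth1 a \<Longrightarrow> smooth1 b \<Longrightarrow> dir_deriv (0, 1) (tensor a b) = tensor a (deriv b)"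
proof -
  have D: "(tensor a b has_derivative (\<lambda>v. a (fst x) * (b' * snd v) + (a' * fst v) * b (snd x))) (at x)"
    if "(a has_real_derivative a') (at (fst x))" "(b has_real_derivative b') (at (snd x))" for a b a' b' x
  proof -
    have "((\<lambda>x. a (fst x)) has_derivative (\<lambda>v. a' * fst v)) (at x)"
      "((\<lambda>x. b (snd x)) has_derivative (\<lambda>v. b' * snd v)) (at x)"
      using that unfolding has_field_derivative_def
      by (auto intro: has_derivative_compose[OF has_derivative_fst[OF has_derivative_ident]]
                      has_derivative_compose[OF has_derivative_snd[OF has_derivative_ident]])
    from has_derivative_mult[OF this] show ?thesis
      by (simp add: tensor_def case_prod_beta')
  qed
  have E: "dir_deriv (1, 0) (tensor a b) = tensor a' b" "dir_deriv (0, 1) (tensor a b) = tensor a b'"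
    "tensor a b differentiable (at z)"
    if "\<And>x. (a has_real_derivative a' x) (at x)" "\<And>x. (b has_real_derivative b' x) (at x)"
    for a b a' b' z
    using dir_deriv_eqI[OF D[OF that]] differentiableI[OF D[OF that]]
    by (auto simp: fun_eq_iff tensor_def)
  show "C_class r (tensor a b)" if "C1_class r a" "C1_class r b"
    using that
  proof (induction r arbitrary: a b)
    case 0
    then have "continuous_on UNIV (\<lambda>x. a (fst x) * b (snd x))"
      by (auto intro!: continuous_intros intro: continuous_on_compose2[of UNIV])
    then show ?case by (simp add: tensor_def case_prod_beta')
  next
    case (Suc r)
    from Suc.prems obtain a' b' where *: "\<And>x. (a has_real_derivative a' x) (at x)" "C1_class r a'"
      "\<And>x. (b has_real_derivative b' x) (at x)" "C1_class r b'" by auto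
    have "C1_class r a" "C1_class r b" using Suc.prems C1_class_mono by blast+
    then show ?case using E[OF *(1,3)] * Suc.IH by simp
  qed
  show "dir_deriv (1, 0) (tensor a b) = tensor (deriv a) b"
    "dir_deriv (0, 1) (tensor a b) = tensor a (deriv b)" if "smooth1 a" "smooth1 b"
    by (rule E(1,2)[OF smooth1_has_deriv[OF that(1)] smooth1_has_deriv[OF that(2)]])+
qed

lemma smooth2_tensor: "smooth1 a \<Longrightarrow> smooth1 b \<Longrightarrow> smooth2 (tensor a b)"
  by (simp add: smooth2_def smooth1_def C_class_tensor)

lemma smooth1_deriv_funpow: "smooth1 a \<Longrightarrow> smooth1 ((deriv ^^ n) a)"
  by (induction n) (simp_all add: smooth1_deriv)

lemma partial_deriv_tensor:
  assumes "smooth1 a" "smooth1 b"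
  shows "partial_deriv (r, s) (tensor a b) = tensor ((deriv ^^ r) a) ((deriv ^^ s) b)"
proof -
  have "(dir_deriv (0, 1) ^^ s) (tensor a b) = tensor a ((deriv ^^ s) b)"
    by (induction s) (use assms in \<open>simp_all add: dir_deriv_tensor smooth1_deriv_funpow\<close>)
  moreover have "(dir_deriv (1, 0) ^^ r) (tensor a c) = tensor ((deriv ^^ r) a) c" if "smooth1 c" for c
    by (induction r) (use assms that in \<open>simp_all add: dir_deriv_tensor smooth1_deriv_funpow\<close>)
  ultimately show ?thesis by (simp add: partial_deriv_def smooth1_deriv_funpow assms)
qed

lemma dir_deriv_eq_0_outside:
  assumes "closed K" "\<And>x. x \<notin> K \<Longrightarrow> g x = 0" "x \<notin> K"
  shows "dir_deriv e g x = 0"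
proof -
  have "((\<lambda>x. 0) has_derivative (\<lambda>v. 0)) (at x)" by simp
  then have "(g has_derivative (\<lambda>v. 0)) (at x)"
    by (rule has_derivative_transform_within_open[where s = "- K"])
       (use assms in \<open>auto simp: open_Compl\<close>)
  from dir_deriv_eqI[OF this] show ?thesis .
qed

lemma dir_deriv_funpow_eq_0_outside:
  "closed K \<Longrightarrow> (\<And>x. x \<notin> K \<Longrightarrow> g x = 0) \<Longrightarrow> x \<notin> K \<Longrightarrow> (dir_deriv e ^^ n) g x = 0"
  by (induction n arbitrary: x) (auto intro: dir_deriv_eq_0_outside)

section \<open>Integration by parts and weak derivatives of smooth functions\<close>

lemma integrable_continuous_compact_support:
  fixes g :: "real \<times> real \<Rightarrow> real"
  assumes "continuous_on UNIV g" "compact K" "\<And>x. x \<notin> K \<Longrightarrow> g x = 0"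
  shows "integrable lborel g"
proof -
  have "integrable lborel (\<lambda>x. indicator K x *\<^sub>R g x)"
    using assms by (intro borel_integrable_compact) (auto intro: continuous_on_subset)
  moreover have "(\<lambda>x. indicator K x *\<^sub>R g x) = g"
    using assms(3) by (auto simp: fun_eq_iff indicator_def)
  ultimately show ?thesis by simp
qed

lemma integral_deriv_compact_support:
  assumes "\<And>x::real. (G has_real_derivative g x) (at x)" "continuous_on UNIV g"
    and "\<And>x. R \<le> \<bar>x\<bar> \<Longrightarrow> G x = 0" "\<And>x. R \<le> \<bar>x\<bar> \<Longrightarrow> g x = 0" "0 \<le> R"
  shows "(LINT x|lborel. g x) = 0"
proof -
  have "indicator {-R..R} x *\<^sub>R g x = g x" for x
  proof (cases "R \<le> \<bar>x\<bar>")
    case False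
    then have "x \<in> {-R..R}" by auto
    then show ?thesis by simp
  qed (simp add: assms(4))
  then have "(LINT x|lborel. g x) = (LINT x|lborel. indicator {-R..R} x *\<^sub>R g x)"
    by (simp only:)
  also have "\<dots> = G R - G (- R)"
    by (rule integral_FTC_atLeastAtMost)
       (use assms(1,2,5) in \<open>auto intro: continuous_on_subset has_vector_derivative_at_within
          simp: has_real_derivative_iff_has_vector_derivative\<close>)
  finally show ?thesis using assms(3)[of R] assms(3)[of "- R"] assms(5) by simp
qed

text \<open>By Fubini one may integrate along the lines parallel to \<open>e\<close> before the
  other variable, and on each such line the fundamental theorem of calculus gives 0.\<close>

lemma integral_dir_deriv_eq_0:
  assumes F: "\<And>x. F differentiable (at x)" and cont: "continuous_on UNIV (dir_deriv e F)"
    and K: "compact K" "\<And>x. x \<notin> K \<Longrightarrow> F x = 0" and e: "e \<in> {(1, 0), (0, 1)}"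
  shows "(LINT x|lborel. dir_deriv e F x) = 0"
proof -
  obtain R where "\<And>x. x \<in> K \<Longrightarrow> norm x \<le> R"
    using compact_imp_bounded[OF K(1)] unfolding bounded_iff by blast
  then have "\<bar>x\<bar> < \<bar>R\<bar> + 1 \<and> \<bar>y\<bar> < \<bar>R\<bar> + 1" if "(x, y) \<in> K" for x y
    using norm_fst_le[of x y] norm_snd_le[of y x] that by fastforce
  \<comment> \<open>The strict bound on the coordinates of points of \<open>K\<close> makes
    \<open>F\<close> and its derivative vanish already at the end points -R and R.\<close>
  then obtain R where R: "0 \<le> R" "\<And>x y. (x, y) \<in> K \<Longrightarrow> \<bar>x\<bar> < R \<and> \<bar>y\<bar> < R"
    using that[of "\<bar>R\<bar> + 1"] by auto
  let ?f = "dir_deriv e F"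
  have out: "?f x = 0" if "x \<notin> K" for x
    using dir_deriv_eq_0_outside[of K F] K that compact_imp_closed by blast
  have out': "F (x, y) = 0 \<and> ?f (x, y) = 0" if "R \<le> \<bar>x\<bar> \<or> R \<le> \<bar>y\<bar>" for x y
    using R(2)[of x y] that out K(2) by force
  have int: "integrable (lborel \<Otimes>\<^sub>M lborel) (case_prod (\<lambda>x y. ?f (x, y)))"
    using integrable_continuous_compact_support[OF cont K(1) out] by (simp add: lborel_prod)
  have D: "(F has_derivative frechet_derivative F (at x)) (at x)" for x
    using F by (simp flip: frechet_derivative_works)
  have prod_eq: "(\<lambda>(x, y). ?f (x, y)) = ?f" by (rule case_prod_eta)
  have lin: "frechet_derivative F (at z) (c *\<^sub>R v) = c * frechet_derivative F (at z) v" for z c v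
    using has_derivative_linear[OF D] by (simp add: linear_cmul)
  have d1: "((\<lambda>x. F (x, y)) has_real_derivative dir_deriv (1, 0) F (x, y)) (at x)" for x y
  proof -
    have "((\<lambda>x. F (x, y)) has_derivative (\<lambda>h. frechet_derivative F (at (x, y)) (h, 0))) (at x)"
      by (rule has_derivative_compose[OF _ D])
         (auto intro!: derivative_eq_intros)
    moreover have "(\<lambda>h. frechet_derivative F (at (x, y)) (h, 0)) = (*) (dir_deriv (1, 0) F (x, y))"
    proof
      show "frechet_derivative F (at (x, y)) (h, 0) = dir_deriv (1, 0) F (x, y) * h" for h
        using lin[of "(x, y)" h "(1, 0)"] by (simp add: dir_deriv_def)
    qed
    ultimately show ?thesis by (simp add: has_field_derivative_def)
  qed
  have d2: "((\<lambda>y. F (x, y)) has_real_derivative dir_deriv (0, 1) F (x, y)) (at y)" for x y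
  proof -
    have "((\<lambda>y. F (x, y)) has_derivative (\<lambda>h. frechet_derivative F (at (x, y)) (0, h))) (at y)"
      by (rule has_derivative_compose[OF _ D])
         (auto intro!: derivative_eq_intros)
    moreover have "(\<lambda>h. frechet_derivative F (at (x, y)) (0, h)) = (*) (dir_deriv (0, 1) F (x, y))"
    proof
      show "frechet_derivative F (at (x, y)) (0, h) = dir_deriv (0, 1) F (x, y) * h" for h
        using lin[of "(x, y)" h "(0, 1)"] by (simp add: dir_deriv_def)
    qed
    ultimately show ?thesis by (simp add: has_field_derivative_def)
  qed
  have sect: "continuous_on UNIV (\<lambda>x. ?f (x, y))" "continuous_on UNIV (\<lambda>y. ?f (x, y))" for x y
    by (intro continuous_on_compose2[OF cont] continuous_intros; simp)+
  from e consider "e = (1, 0)" | "e = (0, 1)" by auto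
  then show ?thesis
  proof cases
    case 1
    have "(LINT x|lborel. ?f (x, y)) = 0" for y
      by (rule integral_deriv_compact_support[of "\<lambda>x. F (x, y)" _ R])
         (use R(1) d1 sect out' in \<open>simp_all add: 1\<close>)
    then show ?thesis using lborel_pair.integral_snd[OF int] unfolding prod_eq lborel_prod by simp
  next
    case 2
    have "(LINT y|lborel. ?f (x, y)) = 0" for x
      by (rule integral_deriv_compact_support[of "\<lambda>y. F (x, y)" _ R])
         (use R(1) d2 sect out' in \<open>simp_all add: 2\<close>)
    then show ?thesis using lborel_pair.integral_fst[OF int] unfolding prod_eq lborel_prod by simp
  qed
qed

lemma integral_by_parts_dir_deriv:
  assumes u: "smooth2 u" and w: "smooth2 w" and K: "compact K" "\<And>x. x \<notin> K \<Longrightarrow> w x = 0"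
    and e: "e \<in> {(1, 0), (0, 1)}"
  shows "(LINT x|lborel. u x * dir_deriv e w x) = - (LINT x|lborel. dir_deriv e u x * w x)"
proof -
  have D: "dir_deriv e (\<lambda>x. u x * w x) x = u x * dir_deriv e w x + dir_deriv e u x * w x" for x
    using dir_deriv_eqI[OF has_derivative_mult[OF smooth2_has_derivative[OF u]
        smooth2_has_derivative[OF w]]] by (simp add: dir_deriv_def)
  note cont = smooth2_continuous[OF u] smooth2_continuous[OF w]
    smooth2_continuous[OF smooth2_dir_deriv[OF u e]] smooth2_continuous[OF smooth2_dir_deriv[OF w e]]
  have i: "integrable lborel (\<lambda>x. u x * dir_deriv e w x)" "integrable lborel (\<lambda>x. dir_deriv e u x * w x)"
    using dir_deriv_eq_0_outside[OF compact_imp_closed[OF K(1)] K(2)] K(2)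
    by (intro integrable_continuous_compact_support[OF _ K(1)] continuous_intros cont; simp)+
  have "continuous_on UNIV (dir_deriv e (\<lambda>x. u x * w x))"
    unfolding D by (intro continuous_intros cont)
  then have "(LINT x|lborel. dir_deriv e (\<lambda>x. u x * w x) x) = 0"
    by (intro integral_dir_deriv_eq_0[OF _ _ K(1) _ e])
       (simp_all add: K(2) differentiable_mult smooth2_differentiable[OF u] smooth2_differentiable[OF w])
  then show ?thesis unfolding D using i by simp
qed

lemma integral_by_parts_dir_deriv_funpow:
  assumes u: "smooth2 u" and w: "smooth2 w" and K: "compact K" "\<And>x. x \<notin> K \<Longrightarrow> w x = 0"
    and e: "e \<in> {(1, 0), (0, 1)}"
  shows "(LINT x|lborel. u x * (dir_deriv e ^^ n) w x)
    = (-1) ^ n * (LINT x|lborel. (dir_deriv e ^^ n) u x * w x)"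
  using u
proof (induction n arbitrary: u)
  case (Suc n)
  have "(LINT x|lborel. u x * (dir_deriv e ^^ Suc n) w x)
      = - (LINT x|lborel. dir_deriv e u x * (dir_deriv e ^^ n) w x)"
    using integral_by_parts_dir_deriv[OF Suc.prems smooth2_dir_deriv_funpow[OF w e, of n] K(1) _ e]
      dir_deriv_funpow_eq_0_outside[OF compact_imp_closed[OF K(1)] K(2)] by simp
  also have "\<dots> = - ((-1) ^ n * (LINT x|lborel. (dir_deriv e ^^ n) (dir_deriv e u) x * w x))"
    by (subst Suc.IH) (use smooth2_dir_deriv Suc.prems e in auto)
  finally show ?case by (simp add: funpow_swap1)
qed simp

text \<open>\<open>partial_deriv\<close> has the derivatives in direction (1, 0) outermost, so they
  are the ones moved to \<open>u\<close> before the others. Hence the weak derivative appears with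
  the two directions in the opposite order, and symmetry of mixed derivatives never has to be
  invoked.\<close>

lemma smooth2_has_weak_deriv:
  assumes u: "smooth2 u"
  shows "has_weak_deriv U (a, b) u ((dir_deriv (0, 1) ^^ b) ((dir_deriv (1, 0) ^^ a) u))"
proof -
  have loc: "locally_integrable U g" if "smooth2 g" for g
    unfolding locally_integrable_def set_integrable_def
    using continuous_on_subset[OF smooth2_continuous[OF that] subset_UNIV] borel_integrable_compact by blast
  let ?u = "(dir_deriv (1, 0) ^^ a) u"
  have su: "smooth2 ?u" by (intro smooth2_dir_deriv_funpow u) simp
  have "(LINT x:U|lborel. u x * partial_deriv (a, b) z x)
      = (-1) ^ (a + b) * (LINT x:U|lborel. (dir_deriv (0, 1) ^^ b) ?u x * z x)"
    if "test_function U z" for z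
  proof -
    from that obtain K where K: "compact K" "K \<subseteq> U" "\<And>x. x \<notin> K \<Longrightarrow> z x = 0" and z: "smooth2 z"
      by (auto simp: test_function_def smooth2_def)
    have drop: "(LINT x:U|lborel. g x * w x) = (LINT x|lborel. g x * w x)"
      if "\<And>x. x \<notin> K \<Longrightarrow> w x = 0" for g w :: "real \<times> real \<Rightarrow> real"
      unfolding set_lebesgue_integral_def
      by (rule Bochner_Integration.integral_cong) (use that K(2) in \<open>auto simp: indicator_def\<close>)
    let ?z = "(dir_deriv (0, 1) ^^ b) z"
    have sz: "smooth2 ?z" by (intro smooth2_dir_deriv_funpow z) simp
    note zero = dir_deriv_funpow_eq_0_outside[OF compact_imp_closed[OF K(1)]]
    have out: "?z x = 0" if "x \<notin> K" for x
      using zero K(3) that by blast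
    have out': "(dir_deriv (1, 0) ^^ a) ?z x = 0" if "x \<notin> K" for x
      using zero out that by blast
    have "(LINT x:U|lborel. u x * partial_deriv (a, b) z x)
        = (LINT x|lborel. u x * (dir_deriv (1, 0) ^^ a) ?z x)"
      unfolding partial_deriv_def fst_conv snd_conv by (rule drop) (rule out')
    also have "\<dots> = (-1) ^ a * (LINT x|lborel. ?u x * ?z x)"
      by (rule integral_by_parts_dir_deriv_funpow[OF u sz K(1) out]) simp_all
    also have "(LINT x|lborel. ?u x * ?z x) = (-1) ^ b * (LINT x|lborel. (dir_deriv (0, 1) ^^ b) ?u x * z x)"
      by (rule integral_by_parts_dir_deriv_funpow[OF su z K(1,3)]) simp_all
    also have "(LINT x|lborel. (dir_deriv (0, 1) ^^ b) ?u x * z x)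
        = (LINT x:U|lborel. (dir_deriv (0, 1) ^^ b) ?u x * z x)"
      using drop[OF K(3)] by simp
    finally show ?thesis by (simp add: power_add)
  qed
  then show ?thesis
    unfolding has_weak_deriv_def using loc u smooth2_dir_deriv_funpow[OF su] by simp
qed

text \<open>Smoothness holds on the whole plane, so \<open>u\<close> and its derivatives are
  continuous on the compact closure of \<open>U\<close>; this settles integrability up to the
  boundary.\<close>

lemma smooth2_in_sobolev:
  assumes "smooth2 u" "0 < p" "bounded U" "U \<in> sets lborel"
  shows "u \<in> sobolev r p U"
proof -
  have Lp: "g \<in> Lp_on p U" if "smooth2 g" for g
  proof -
    have c: "continuous_on A g" for A using smooth2_continuous[OF that] continuous_on_subset by blast
    have [measurable]: "g \<in> borel_measurable lborel"
      using borel_measurable_continuous_onI[OF c] by simp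
    have "set_integrable lborel (closure U) (\<lambda>x. \<bar>g x\<bar> powr p)"
      unfolding set_integrable_def using assms c
      by (intro borel_integrable_compact continuous_on_powr' continuous_intros) (auto intro: c)
    then show ?thesis
      using assms(4) set_integrable_subset[OF _ assms(4) closure_subset]
      by (auto simp: Lp_on_def set_borel_measurable_def)
  qed
  have "\<exists>g\<in>Lp_on p U. has_weak_deriv U \<alpha> u g" for \<alpha>
    using smooth2_has_weak_deriv[OF assms(1), of U "fst \<alpha>" "snd \<alpha>"]
      Lp[OF smooth2_dir_deriv_funpow[OF smooth2_dir_deriv_funpow[OF assms(1)]],
        of "(1, 0)" "(0, 1)" "snd \<alpha>" "fst \<alpha>"]
    unfolding prod.collapse by (simp add: bexI)
  then show ?thesis by (simp add: sobolev_def Lp assms(1))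
qed

section \<open>Essential supports and interpolation by translates\<close>

text \<open>Since \<open>ennreal\<close> sends negative numbers to 0, \<open>?M\<close> and
  \<open>?N\<close> have the positive and the negative part of \<open>h\<close> as densities. These
  finite measures agree on boxes, an intersection-stable generator of the Borel sets, hence
  everywhere. Equal positive and negative parts mean that \<open>h\<close> vanishes.\<close>

lemma AE_eq_0_if_box_integrals_eq_0:
  fixes h :: "'a::euclidean_space \<Rightarrow> real"
  assumes int: "integrable lborel h"
    and zero: "\<And>l u. (LINT x:box l u|lborel. h x) = 0"
  shows "AE x in lborel. h x = 0"
proof -
  let ?M = "density lborel (\<lambda>x. ennreal (h x))" and ?N = "density lborel (\<lambda>x. ennreal (- h x))"
  have [measurable]: "h \<in> borel_measurable borel" using int by auto
  have fin: "(\<integral>\<^sup>+x. ennreal (h x) \<partial>lborel) \<noteq> \<infinity>" "(\<integral>\<^sup>+x. ennreal (- h x) \<partial>lborel) \<noteq> \<infinity>"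
    using int by (auto simp: real_integrable_def)
  have eq: "emeasure ?M (box l u) = emeasure ?N (box l u)" for l u
  proof -
    have i: "integrable lborel (\<lambda>x. indicator (box l u) x * h x)"
      using integrable_real_mult_indicator[OF _ int] by (simp add: mult.commute)
    have "ennreal (indicator (box l u) x * h x) = ennreal (h x) * indicator (box l u) x"
      "ennreal (- (indicator (box l u) x * h x)) = ennreal (- h x) * indicator (box l u) x" for x
      by (auto simp: indicator_def)
    then have *: "emeasure ?M (box l u) = (\<integral>\<^sup>+x. ennreal (indicator (box l u) x * h x) \<partial>lborel)"
      "emeasure ?N (box l u) = (\<integral>\<^sup>+x. ennreal (- (indicator (box l u) x * h x)) \<partial>lborel)"
      by (simp_all add: emeasure_density)
    have "enn2real (emeasure ?M (box l u)) = enn2real (emeasure ?N (box l u))"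
      using zero[of l u] real_lebesgue_integral_def[OF i]
      by (simp add: * set_lebesgue_integral_def)
    moreover have "emeasure ?M (box l u) \<noteq> \<infinity>" "emeasure ?N (box l u) \<noteq> \<infinity>"
      using i by (auto simp: * real_integrable_def)
    ultimately show ?thesis by (metis ennreal_enn2real infinity_ennreal_def less_top)
  qed
  have "?M = ?N"
  proof (rule measure_eqI_generator_eq)
    let ?E = "range (\<lambda>(a, b). box a b :: 'a set)"
    show "Int_stable ?E" by (auto simp: Int_stable_def box_Int_box)
    show "?E \<subseteq> Pow UNIV" "sets ?M = sigma_sets UNIV ?E" "sets ?N = sigma_sets UNIV ?E"
      by (simp_all add: borel_eq_box)
    let ?A = "\<lambda>n::nat. box (- (real n *\<^sub>R One)) (real n *\<^sub>R One) :: 'a set"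
    show "range ?A \<subseteq> ?E" "(\<Union>i. ?A i) = UNIV" unfolding UN_box_eq_UNIV by auto
    show "emeasure ?M X = emeasure ?N X" if "X \<in> ?E" for X using that eq by auto
    show "emeasure ?M (?A i) \<noteq> \<infinity>" for i
    proof -
      have "emeasure ?M (?A i) \<le> emeasure ?M UNIV" by (rule emeasure_mono) auto
      then show ?thesis using fin(1) by (auto simp: emeasure_density top_unique)
    qed
  qed
  then have "AE x in lborel. ennreal (h x) = ennreal (- h x)"
    by (subst (asm) finite_density_unique) (use fin in auto)
  then show ?thesis
    by eventually_elim (metis ennreal_eq_0_iff ennreal_inj linorder_le_cases neg_0_le_iff_le
        neg_equal_zero neg_le_0_iff_le order_antisym_conv)
qed

lemma box_real_Pair: "box (a, c) (b, d) = {a<..<b} \<times> {c<..<d :: real}" for a b :: real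
  by (force simp: box_def Basis_prod_def)

lemma flat_exp_tendsto_indicator: "(\<lambda>n. flat_exp (real n * t)) \<longlonglongrightarrow> indicator {0<..} t"
proof (cases "t > 0")
  case True
  have "(\<lambda>n. exp (- (1 / real n * (1 / t)))) \<longlonglongrightarrow> exp (- (0 * (1 / t)))"
    by (intro tendsto_exp tendsto_minus tendsto_mult lim_1_over_n tendsto_const)
  then have "(\<lambda>n. flat_exp (real n * t)) \<longlonglongrightarrow> exp (- (0 * (1 / t)))"
    by (rule Lim_transform_eventually)
       (use True in \<open>auto simp: flat_exp_def mult_le_0_iff intro!: eventually_sequentiallyI[of 1]\<close>)
  then show ?thesis using True by simp
next
  case False
  then have "flat_exp (real n * t) = 0" for n by (simp add: flat_exp_def mult_le_0_iff)
  then show ?thesis using False by simp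
qed

text \<open>By contradiction: if every smooth function living in the box annihilates
  \<open>g\<close>, a passage to the limit shows that \<open>g\<close> has integral 0 over every
  subbox, and then \<open>g\<close> vanishes almost everywhere in the box.\<close>

lemma smooth2_separates:
  fixes g :: "real \<times> real \<Rightarrow> real"
  assumes int: "integrable lborel g" and nz: "\<not> (AE x in lborel. x \<in> box l u \<longrightarrow> g x = 0)"
  obtains w where "smooth2 w" "\<And>x. x \<notin> box l u \<Longrightarrow> w x = 0" "(LINT x|lborel. w x * g x) \<noteq> 0"
proof -
  have False if zero: "\<And>w. smooth2 w \<Longrightarrow> (\<And>x. x \<notin> box l u \<Longrightarrow> w x = 0) \<Longrightarrow> (LINT x|lborel. w x * g x) = 0"
  proof -
    have [measurable]: "g \<in> borel_measurable borel" using int by auto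
    have box_zero: "(LINT x|lborel. indicator (box a b) x * g x) = 0" if sub: "box a b \<subseteq> box l u" for a b
    proof -
      \<comment> \<open>A smooth bump that is positive exactly on (a, b) when n > 0, bounded by 1,
        and tends to the indicator of (a, b) as n grows.\<close>
      define be where "be n a b t = flat_exp (real n * (t - a)) * flat_exp (real n * (b - t))"
        for n :: nat and a b t :: real
      define w where "w n = tensor (be n (fst a) (fst b)) (be n (snd a) (snd b))" for n
      have "smooth1 (be n a b)" for n a b
        using smooth1_mult[OF smooth1_affine[OF smooth1_flat_exp, of "real n" "- (real n * a)"]
          smooth1_affine[OF smooth1_flat_exp, of "- real n" "real n * b"]]
        unfolding be_def by (simp add: algebra_simps)
      then have sw: "smooth2 (w n)" for n unfolding w_def by (intro smooth2_tensor)
      have be_lim: "(\<lambda>n. be n a b t) \<longlonglongrightarrow> indicator {a<..<b} t" for a b t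
      proof -
        have "indicator {a<..<b} t = indicator {0<..} (t - a) * (indicator {0<..} (b - t) :: real)"
          by (auto simp: indicator_def)
        then show ?thesis unfolding be_def
          by (auto intro!: tendsto_mult flat_exp_tendsto_indicator)
      qed
      have box_eq: "box a b = {fst a<..<fst b} \<times> {snd a<..<snd b}"
        using box_real_Pair[of "fst a" "snd a" "fst b" "snd b"] by simp
      have be_bound: "0 \<le> be n a b t" "be n a b t \<le> 1" for n a b t
        unfolding be_def using flat_exp_bounds by (auto intro: mult_le_one)
      have be_zero: "be n a b t = 0" if "t \<notin> {a<..<b}" for n a b t
        using that by (auto simp: be_def flat_exp_def mult_le_0_iff not_less)
      have [measurable]: "w n \<in> borel_measurable borel" for n
        by (rule borel_measurable_continuous_onI[OF smooth2_continuous[OF sw]])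
      have "(\<lambda>n. LINT x|lborel. w n x * g x) \<longlonglongrightarrow> (LINT x|lborel. indicator (box a b) x * g x)"
      proof (rule integral_dominated_convergence[where w = "\<lambda>x. \<bar>g x\<bar>"])
        show "integrable lborel (\<lambda>x. \<bar>g x\<bar>)" using int by auto
        show "AE x in lborel. (\<lambda>n. w n x * g x) \<longlonglongrightarrow> indicator (box a b) x * g x"
        proof (intro AE_I2 tendsto_mult tendsto_const)
          fix x :: "real \<times> real"
          have "indicator (box a b) x = indicator {fst a<..<fst b} (fst x) * (indicator {snd a<..<snd b} (snd x) :: real)"
            unfolding box_eq by (cases x) (auto simp: indicator_def)
          then show "(\<lambda>n. w n x) \<longlonglongrightarrow> indicator (box a b) x"
            unfolding w_def tensor_def case_prod_beta by (auto intro!: tendsto_mult be_lim)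
        qed
        have "\<bar>w n x\<bar> \<le> 1" for n x
          unfolding w_def tensor_def case_prod_beta using be_bound
          by (simp add: abs_mult mult_le_one)
        then show "AE x in lborel. norm (w n x * g x) \<le> \<bar>g x\<bar>" for n
          by (intro AE_I2) (simp only: real_norm_def abs_mult mult_left_le_one_le abs_ge_zero)
      qed auto
      moreover have "w n x = 0" if "x \<notin> box l u" for n x
      proof -
        have "x \<notin> box a b" using that sub by blast
        then show ?thesis unfolding w_def tensor_def box_eq by (cases x) (auto simp: be_zero)
      qed
      then have "(LINT x|lborel. w n x * g x) = 0" for n using zero sw by blast
      ultimately show ?thesis by (simp add: LIMSEQ_const_iff)
    qed
    have "AE x in lborel. indicator (box l u) x * g x = 0"
    proof (rule AE_eq_0_if_box_integrals_eq_0)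
      show "integrable lborel (\<lambda>x. indicator (box l u) x * g x)"
        using integrable_real_mult_indicator[OF _ int] by (simp add: mult.commute)
      fix a b :: "real \<times> real"
      \<comment> \<open>The intersection of two boxes is a box, so arbitrary boxes reduce to
        subboxes of \<open>box l u\<close>.\<close>
      obtain c d where cd: "box a b \<inter> box l u = box c d" unfolding box_Int_box by blast
      have "(LINT x:box a b|lborel. indicator (box l u) x * g x) = (LINT x|lborel. indicator (box c d) x * g x)"
        unfolding set_lebesgue_integral_def cd[symmetric] by (simp add: indicator_inter_arith mult.assoc)
      also have "\<dots> = 0" using cd by (intro box_zero) blast
      finally show "(LINT x:box a b|lborel. indicator (box l u) x * g x) = 0" .
    qed
    with nz show False by (auto elim!: eventually_mono simp: indicator_def)
  qed
  then show thesis using that by blast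
qed

section \<open>Essential supports\<close>

lemma open_Compl_ess_supp: "open (- ess_supp f)"
proof (subst open_subopen, intro ballI)
  fix x assume "x \<in> - ess_supp f"
  then obtain U where U: "open U" "x \<in> U" "AE y in lborel. y \<in> U \<longrightarrow> f y = 0"
    unfolding ess_supp_def by blast
  then have "U \<subseteq> - ess_supp f" unfolding ess_supp_def by blast
  with U show "\<exists>T. open T \<and> x \<in> T \<and> T \<subseteq> - ess_supp f" by blast
qed

lemma closed_ess_supp: "closed (ess_supp f)"
  using open_Compl_ess_supp by (simp add: closed_def)

text \<open>The complement is a union of possibly uncountably many open sets on which
  \<open>f\<close> vanishes almost everywhere. By Lindelof countably many of them suffice, and
  countably many null sets may be united.\<close>

lemma AE_eq_0_outside_ess_supp: "AE x in lborel. x \<notin> ess_supp f \<longrightarrow> f x = 0"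
proof -
  let ?F = "{U. open U \<and> (AE y in lborel. y \<in> U \<longrightarrow> f y = 0)}"
  obtain F where F: "F \<subseteq> ?F" "countable F" "\<Union>F = \<Union>?F"
    using Lindelof[of ?F] by blast
  have "AE y in lborel. \<forall>U\<in>F. y \<in> U \<longrightarrow> f y = 0"
    using F by (subst AE_ball_countable) auto
  moreover have "x \<in> \<Union>F" if x: "x \<notin> ess_supp f" for x
  proof -
    obtain U where "open U" "x \<in> U" "AE y in lborel. y \<in> U \<longrightarrow> f y = 0"
      using x unfolding ess_supp_def by blast
    then have "x \<in> \<Union>?F" by blast
    then show ?thesis using F(3) by simp
  qed
  ultimately show ?thesis by (auto elim!: eventually_mono)
qed

lemma AE_lborel_affine_iff:
  fixes t :: "'a::euclidean_space"
  assumes "c \<noteq> 0" "Measurable.pred borel P"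
  shows "(AE x in lborel. P (t + c *\<^sub>R x)) \<longleftrightarrow> (AE x in lborel. P x)"
proof -
  have "(AE x in lborel. P x) \<longleftrightarrow>
    (AE x in density (distr lborel borel (\<lambda>x. t + c *\<^sub>R x)) (\<lambda>_. \<bar>c\<bar> ^ DIM('a)). P x)"
    by (rule arg_cong[where f = "\<lambda>M. almost_everywhere M P"], rule lborel_affine[OF assms(1)])
  also have "\<dots> \<longleftrightarrow> (AE x in distr lborel borel (\<lambda>x. t + c *\<^sub>R x). P x)"
    using assms(1) by (subst AE_density) (auto simp: ennreal_zero_less_mult_iff)
  also have "\<dots> \<longleftrightarrow> (AE x in lborel. P (t + c *\<^sub>R x))"
    using assms(2) by (subst AE_distr_iff) (auto simp: pred_def)
  finally show ?thesis by simp
qed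

lemma integrable_lborel_affine:
  fixes f :: "'a::euclidean_space \<Rightarrow> real"
  assumes "c \<noteq> 0" "integrable lborel f"
  shows "integrable lborel (\<lambda>x. f (t + c *\<^sub>R x))"
proof -
  have [measurable]: "f \<in> borel_measurable borel" using assms(2) by auto
  have "integrable (density (distr lborel borel (\<lambda>x. t + c *\<^sub>R x)) (\<lambda>_. ennreal (\<bar>c\<bar> ^ DIM('a)))) f"
    using assms(2) lborel_affine[OF assms(1), of t] by (simp add: ennreal_power)
  then have "integrable (distr lborel borel (\<lambda>x. t + c *\<^sub>R x)) (\<lambda>x. \<bar>c\<bar> ^ DIM('a) * f x)"
    by (subst (asm) integrable_real_density) auto
  then have "integrable (distr lborel borel (\<lambda>x. t + c *\<^sub>R x)) f" using assms(1) by simp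
  then show ?thesis by (subst (asm) integrable_distr_eq) auto
qed

text \<open>The affine map is a homeomorphism that preserves null sets in both directions, so open
  sets witnessing that a point is outside the support can be transported either way.\<close>

lemma ess_supp_affine:
  fixes f :: "'a::euclidean_space \<Rightarrow> real"
  assumes "c \<noteq> 0" "k \<noteq> 0" and [measurable]: "f \<in> borel_measurable borel"
  shows "x \<in> ess_supp (\<lambda>x. k * f (c *\<^sub>R x - t)) \<longleftrightarrow> c *\<^sub>R x - t \<in> ess_supp f"
proof -
  have AE: "(AE y in lborel. c *\<^sub>R y - t \<in> V \<longrightarrow> k * f (c *\<^sub>R y - t) = 0)
      \<longleftrightarrow> (AE y in lborel. y \<in> V \<longrightarrow> f y = 0)" if "open V" for V
  proof -
    have "{y. y \<in> V \<longrightarrow> f y = 0} = - V \<union> f -` {0}" by auto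
    moreover have "f -` {0} \<in> sets borel"
      using measurable_sets[OF assms(3), of "{0}"] by simp
    ultimately have "Measurable.pred borel (\<lambda>y. y \<in> V \<longrightarrow> f y = 0)"
      using that by (simp add: pred_def borel_open )
    from AE_lborel_affine_iff[OF assms(1) this, of "- t"] assms(2) show ?thesis by simp
  qed
  have inv: "c *\<^sub>R ((1 / c) *\<^sub>R (y + t)) - t = y" "(1 / c) *\<^sub>R (c *\<^sub>R y - t + t) = y" for y
    using assms(1) by simp_all
  have o1: "open ((\<lambda>y. c *\<^sub>R y - t) -` V)" if "open V" for V
    using that by (intro open_vimage continuous_intros)
  have o2: "open ((\<lambda>y. (1 / c) *\<^sub>R (y + t)) -` V)" if "open V" for V
    using that by (intro open_vimage continuous_intros)
  show ?thesis
  proof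
    assume L: "x \<in> ess_supp (\<lambda>x. k * f (c *\<^sub>R x - t))"
    show "c *\<^sub>R x - t \<in> ess_supp f" unfolding ess_supp_def
    proof (clarify)
      fix V assume V: "open V" "c *\<^sub>R x - t \<in> V" "AE y in lborel. y \<in> V \<longrightarrow> f y = 0"
      then show False using L o1[OF V(1)] AE[OF V(1)] unfolding ess_supp_def by auto
    qed
  next
    assume R: "c *\<^sub>R x - t \<in> ess_supp f"
    show "x \<in> ess_supp (\<lambda>x. k * f (c *\<^sub>R x - t))" unfolding ess_supp_def
    proof (clarify)
      fix V assume V: "open V" "x \<in> V" "AE y in lborel. y \<in> V \<longrightarrow> k * f (c *\<^sub>R y - t) = 0"
      let ?V = "(\<lambda>y. (1 / c) *\<^sub>R (y + t)) -` V"
      have "AE y in lborel. y \<in> ?V \<longrightarrow> f y = 0"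
        using V(3) unfolding AE[OF o2[OF V(1)], symmetric] by (simp only: vimage_eq inv)
      moreover have "c *\<^sub>R x - t \<in> ?V" using V(2) by (simp only: vimage_eq inv)
      ultimately show False using R o2[OF V(1)] unfolding ess_supp_def by blast
    qed
  qed
qed

section \<open>Triangular systems and interpolation\<close>

text \<open>Elimination in order of increasing \<open>key\<close>, with \<open>P\<close> playing the
  role of a vector space. The induction carries along that the partial solution vanishes at all
  indices beyond those already treated; without this the value at the next index could not be
  prescribed freely.\<close>

lemma triangular_system_solvable:
  fixes L :: "'u \<Rightarrow> 'k \<Rightarrow> real" and key :: "'k \<Rightarrow> real"
  assumes "finite K" "inj_on key K" "P z"
    and comb: "\<And>u w a b. P u \<Longrightarrow> P w \<Longrightarrow> \<exists>v. P v \<and> (\<forall>k\<in>K. L v k = a * L u k + b * L w k)"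
    and tri: "\<And>k. k \<in> K \<Longrightarrow> \<exists>w. P w \<and> L w k \<noteq> 0 \<and> (\<forall>l\<in>K. key k < key l \<longrightarrow> L w l = 0)"
  shows "\<exists>u. P u \<and> (\<forall>k\<in>K. L u k = b k)"
proof -
  have "J \<subseteq> K \<Longrightarrow> \<exists>u. P u \<and> (\<forall>k\<in>J. L u k = b k) \<and> (\<forall>l\<in>K. (\<forall>k\<in>J. key k < key l) \<longrightarrow> L u l = 0)"
    if "finite J" for J
    using that
  proof (induction J arbitrary: b rule: finite_ranking_induct[where f = key])
    case empty
    show ?case using comb[OF \<open>P z\<close> \<open>P z\<close>, of 0 0] by auto
  next
    case (insert x J)
    show ?case
    proof (cases "x \<in> J")
      case True
      then show ?thesis using insert by (simp add: insert_absorb)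
    next
      case False
      obtain w where w: "P w" "L w x \<noteq> 0" "\<forall>l\<in>K. key x < key l \<longrightarrow> L w l = 0"
        using tri insert.prems by blast
      \<comment> \<open>The correction by \<open>w\<close> fixes the value at \<open>x\<close> but
        may disturb the earlier indices. Its effect there is subtracted from the targets in advance,
        which is why the induction is over arbitrary \<open>b\<close>.\<close>
      let ?c = "b x / L w x"
      obtain u where u: "P u" "\<forall>k\<in>J. L u k = b k - ?c * L w k"
        "\<forall>l\<in>K. (\<forall>k\<in>J. key k < key l) \<longrightarrow> L u l = 0"
        using insert.IH[of "\<lambda>k. b k - ?c * L w k"] insert.prems by blast
      obtain v where v: "P v" "\<forall>k\<in>K. L v k = 1 * L u k + ?c * L w k"
        using comb[OF u(1) w(1)] by blast
      have "key k < key x" if "k \<in> J" for k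
        using insert.hyps(2)[OF that] False that insert.prems inj_onD[OF assms(2), of k x]
        by (metis insert_subset order_le_less subsetD)
      then have "L u x = 0" using u(3) insert.prems by blast
      then have "\<forall>k\<in>insert x J. L v k = b k" using v u(2) w(2) insert.prems by auto
      then show ?thesis using v u(3) w(3) by (intro exI[of _ v]) (use insert.prems in auto)
    qed
  qed
  from this[OF assms(1) order_refl] show ?thesis by blast
qed

lemma unit_square_eq_box: "unit_square = box (0, 0) (1, 1)"
  by (simp add: unit_square_def box_real_Pair)

lemma closure_unit_square: "closure unit_square = cbox (0, 0) (1, 1)"
proof -
  have "(1/2, 1/2) \<in> box (0::real, 0::real) (1, 1)" by (simp add: box_real_Pair)
  then show ?thesis unfolding unit_square_eq_box by (intro closure_box) blast
qed

lemma sets_unit_square[measurable]: "unit_square \<in> sets borel"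
  by (simp add: unit_square_eq_box)

text \<open>The support of \<open>h\<close> may touch the boundary of the square, but the boundary
  is a null set.\<close>

lemma integral_over_unit_square:
  assumes "ess_supp h \<subseteq> closure unit_square"
    "h \<in> borel_measurable borel" "u \<in> borel_measurable borel"
  shows "(LINT x:unit_square|lborel. u x * h x) = (LINT x|lborel. u x * h x)"
proof -
  have "cbox (0, 0) (1, 1) - box (0, 0) (1, 1) \<in> null_sets (lborel :: (real \<times> real) measure)"
    using negligible_frontier_interval[of "(0::real, 0::real)" "(1, 1)"]
    by (simp add: negligible_iff_null_sets null_sets_completion_iff)
  then have "AE x in lborel. x \<notin> closure unit_square - unit_square"
    unfolding closure_unit_square by (subst unit_square_eq_box) (rule AE_not_in)
  then have "AE x in lborel. indicator unit_square x *\<^sub>R (u x * h x) = u x * h x"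
    using AE_eq_0_outside_ess_supp[of h]
    by eventually_elim (use assms(1) in \<open>auto simp: indicator_def\<close>)
  then show ?thesis unfolding set_lebesgue_integral_def
    using assms by (intro integral_cong_AE) auto
qed

lemma set_integrable_smooth2_mult:
  assumes "smooth2 u" "integrable lborel h"
  shows "set_integrable lborel unit_square (\<lambda>x. u x * h x)"
proof -
  have "bounded (u ` cbox (0, 0) (1, 1))"
    by (intro compact_imp_bounded compact_continuous_image compact_cbox
        continuous_on_subset[OF smooth2_continuous[OF assms(1)]]) simp
  then obtain B where B: "\<And>x. x \<in> cbox (0, 0) (1, 1) \<Longrightarrow> \<bar>u x\<bar> \<le> B"
    unfolding bounded_iff by auto
  have [measurable]: "u \<in> borel_measurable borel" "h \<in> borel_measurable borel"
    using borel_measurable_continuous_onI[OF smooth2_continuous[OF assms(1)]] assms(2) by auto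
  show ?thesis unfolding set_integrable_def
  proof (rule Bochner_Integration.integrable_bound[of _ "\<lambda>x. B * h x"])
    show "integrable lborel (\<lambda>x. B * h x)" using assms(2) by simp
    have "\<bar>u x * h x\<bar> \<le> \<bar>B * h x\<bar>" if "x \<in> unit_square" for x
    proof -
      have "\<bar>u x\<bar> \<le> B" using that box_subset_cbox B unfolding unit_square_eq_box by blast
      then show ?thesis by (auto simp: abs_mult intro!: mult_right_mono)
    qed
    then show "AE x in lborel. norm (indicator unit_square x *\<^sub>R (u x * h x)) \<le> norm (B * h x)"
      by (auto simp: indicator_def)
  qed auto
qed

text \<open>Ordering the translates by a linear functional that is injective on \<open>K\<close> makes the system
  triangular: near the point of the support of one translate where the functional is least, all
  later translates vanish.\<close>

lemma translates_interpolate: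
  fixes K :: "(int \<times> int) set" and g :: "real \<times> real \<Rightarrow> real"
  assumes "finite K" "integrable lborel g" "compact (ess_supp g)" "ess_supp g \<noteq> {}"
    and c: "0 < c" and mu: "0 < \<mu>" and kap: "\<kappa> \<noteq> 0"
    and sub: "\<And>k. k \<in> K \<Longrightarrow> ess_supp (\<lambda>x. \<kappa> * g (c *\<^sub>R x - \<mu> *\<^sub>R lattice_pt k)) \<subseteq> closure unit_square"
  shows "\<exists>u. smooth2 u \<and>
    (\<forall>k\<in>K. (LINT x:unit_square|lborel. u x * (\<kappa> * g (c *\<^sub>R x - \<mu> *\<^sub>R lattice_pt k))) = b k)"
proof -
  define h where "h k x = \<kappa> * g (c *\<^sub>R x - \<mu> *\<^sub>R lattice_pt k)" for k x
  have [measurable]: "g \<in> borel_measurable borel" using assms(2) by auto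
  have hm[measurable]: "h k \<in> borel_measurable borel" for k unfolding h_def by measurable
  have um: "smooth2 u \<Longrightarrow> u \<in> borel_measurable borel" for u
    using borel_measurable_continuous_onI[OF smooth2_continuous] by blast
  have hi: "integrable lborel (h k)" for k
    unfolding h_def using integrable_lborel_affine[of c g "- (\<mu> *\<^sub>R lattice_pt k)"] assms(2) c by simp
  have supp: "x \<in> ess_supp (h k) \<longleftrightarrow> c *\<^sub>R x - \<mu> *\<^sub>R lattice_pt k \<in> ess_supp g" for x k
    unfolding h_def using c kap by (intro ess_supp_affine) auto
  have "\<exists>N::real. inj_on (\<lambda>k. real_of_int (fst k) * N + real_of_int (snd k)) K"
  proof -
    obtain B where B: "\<And>k. k \<in> K \<Longrightarrow> \<bar>snd k\<bar> \<le> B"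
      using assms(1) by (intro that[of "Max (insert 0 ((\<lambda>k. \<bar>snd k\<bar>) ` K))"]) auto
    \<comment> \<open>An explicit generic direction: second coordinates differ by at most 2B, so the
      weight 2B + 1 on the first coordinate separates points like the digits of a number.\<close>
    have "inj_on (\<lambda>k. real_of_int (fst k) * real_of_int (2 * B + 1) + real_of_int (snd k)) K"
    proof (rule inj_onI)
      fix k l assume kl: "k \<in> K" "l \<in> K" and
        kl_eq: "real_of_int (fst k) * real_of_int (2 * B + 1) + real_of_int (snd k)
          = real_of_int (fst l) * real_of_int (2 * B + 1) + real_of_int (snd l)"
      then have eq: "(fst k - fst l) * (2 * B + 1) = snd l - snd k"
        unfolding of_int_mult[symmetric] of_int_add[symmetric] of_int_eq_iff by (simp add: algebra_simps)
      have "fst k = fst l"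
      proof (rule ccontr)
        assume "fst k \<noteq> fst l"
        then have "1 * (2 * B + 1) \<le> \<bar>fst k - fst l\<bar> * \<bar>2 * B + 1\<bar>"
          using B[OF kl(1)] by (intro mult_mono) auto
        also have "\<dots> = \<bar>snd l - snd k\<bar>" by (simp flip: eq add: abs_mult)
        finally have "2 * B + 1 \<le> \<bar>snd l - snd k\<bar>" by simp
        also have "\<dots> \<le> \<bar>snd l\<bar> + \<bar>snd k\<bar>" by (rule abs_triangle_ineq4)
        also have "\<dots> \<le> B + B" using kl by (intro add_mono B)
        finally show False by simp
      qed
      with eq show "k = l" by (simp add: prod_eq_iff)
    qed
    then show ?thesis by blast
  qed
  then obtain N :: real where N: "inj_on (\<lambda>k. real_of_int (fst k) * N + real_of_int (snd k)) K"
    by blast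
  define e where "e x = fst x * N + snd x" for x :: "real \<times> real"
  define key where "key k = e (lattice_pt k)" for k
  have e_lin: "e (a *\<^sub>R x - b *\<^sub>R y) = a * e x - b * e y" for a b x y
    by (simp add: e_def algebra_simps)
  obtain x0 where x0: "x0 \<in> ess_supp g" "\<And>x. x \<in> ess_supp g \<Longrightarrow> e x0 \<le> e x"
  proof -
    have "continuous_on (ess_supp g) e" unfolding e_def by (intro continuous_intros)
    from continuous_attains_inf[OF assms(3,4) this] show thesis using that by blast
  qed
  show ?thesis unfolding h_def[symmetric]
  \<comment> \<open>The function \<open>z\<close> only shows that there is a smooth function at all;
    any other would serve.\<close>
  proof (rule triangular_system_solvable[where key = key and z = "tensor (\<lambda>x. cos x) (\<lambda>x. cos x)"
        and L = "\<lambda>u k. LINT x:unit_square|lborel. u x * h k x"])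
    show "finite K" by fact
    show "inj_on key K" using N by (simp add: inj_on_def key_def e_def lattice_pt_def)
    show "smooth2 (tensor (\<lambda>x. cos x) (\<lambda>x. cos x))"
      using smooth2_tensor[OF smooth1_cos[of 1 0] smooth1_cos[of 1 0]] by simp
    fix u w a b assume uw: "smooth2 u" "smooth2 w"
    show "\<exists>v. smooth2 v \<and> (\<forall>k\<in>K. (LINT x:unit_square|lborel. v x * h k x)
        = a * (LINT x:unit_square|lborel. u x * h k x) + b * (LINT x:unit_square|lborel. w x * h k x))"
    proof (intro exI[of _ "\<lambda>x. a * u x + b * w x"] conjI ballI smooth2_lincomb uw)
      fix k
      show "(LINT x:unit_square|lborel. (a * u x + b * w x) * h k x)
        = a * (LINT x:unit_square|lborel. u x * h k x) + b * (LINT x:unit_square|lborel. w x * h k x)"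
        using set_integrable_smooth2_mult[OF uw(1) hi[of k]] set_integrable_smooth2_mult[OF uw(2) hi[of k]]
        by (simp add: algebra_simps flip: set_integral_mult_right)
    qed
  next
    fix k assume k: "k \<in> K"
    \<comment> \<open>The point at which the support of \<open>h k\<close> attains the minimum of
      \<open>e\<close>: the affine map in \<open>h k\<close> sends it to \<open>x0\<close>. For a
      later \<open>l\<close> the map in \<open>h l\<close> sends it to a point whose
      \<open>e\<close>-value lies below the minimum over the support of \<open>g\<close>.\<close>
    define xk where "xk = (1 / c) *\<^sub>R (x0 + \<mu> *\<^sub>R lattice_pt k)"
    have xk: "xk \<in> ess_supp (h k)" unfolding supp xk_def using c x0 by simp
    have "xk \<notin> ess_supp (h l)" if "key k < key l" for l
    proof
      assume "xk \<in> ess_supp (h l)"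
      then have "e x0 \<le> e (c *\<^sub>R xk - \<mu> *\<^sub>R lattice_pt l)" using x0(2) supp by blast
      also have "c *\<^sub>R xk - \<mu> *\<^sub>R lattice_pt l = 1 *\<^sub>R x0 - \<mu> *\<^sub>R (lattice_pt l - lattice_pt k)"
        unfolding xk_def using c by (simp add: algebra_simps)
      also have "e \<dots> = e x0 - \<mu> * (key l - key k)"
        unfolding e_lin key_def using e_lin[of 1 "lattice_pt l" 1 "lattice_pt k"] by simp
      finally show False using that mu by (simp add: mult_le_0_iff)
    qed
    then have xk_in: "xk \<in> (\<Inter>l\<in>{l\<in>K. key k < key l}. - ess_supp (h l))" by simp
    have "open (\<Inter>l\<in>{l\<in>K. key k < key l}. - ess_supp (h l))"
      using assms(1) by (intro open_INT) (auto simp: open_Compl_ess_supp)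
    then obtain l u where lu: "box l u \<subseteq> (\<Inter>l\<in>{l\<in>K. key k < key l}. - ess_supp (h l))" "xk \<in> box l u"
      by (rule open_contains_box[OF _ xk_in])
    have "\<not> (AE x in lborel. x \<in> box l u \<longrightarrow> h k x = 0)"
      using xk lu(2) unfolding ess_supp_def by auto
    then obtain w where w: "smooth2 w" "\<And>x. x \<notin> box l u \<Longrightarrow> w x = 0" "(LINT x|lborel. w x * h k x) \<noteq> 0"
      using smooth2_separates[OF hi] by blast
    have "(LINT x:unit_square|lborel. w x * h l x) = 0" if l: "l \<in> K" "key k < key l" for l
    proof -
      have "AE x in lborel. w x * h l x = 0"
        using AE_eq_0_outside_ess_supp[of "h l"] by eventually_elim (use lu(1) l w(2) in auto)
      then have "(LINT x|lborel. w x * h l x) = 0"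
        by (rule integral_eq_zero_AE)
      then show ?thesis
        using integral_over_unit_square[of "h l" w] sub[OF l(1)] um[OF w(1)] by (simp flip: h_def)
    qed
    then show "\<exists>w. smooth2 w \<and> (LINT x:unit_square|lborel. w x * h k x) \<noteq> 0 \<and>
        (\<forall>l\<in>K. key k < key l \<longrightarrow> (LINT x:unit_square|lborel. w x * h l x) = 0)"
      using w integral_over_unit_square[of "h k" w] sub[OF k] um[OF w(1)] by (auto simp flip: h_def)
  qed
qed

section \<open>Means of the primitives of framelets\<close>

lemma deriv_funpow_cong:
  assumes "open S" "\<And>x. x \<in> S \<Longrightarrow> f x = g x" "x \<in> S"
  shows "(deriv ^^ n) f x = (deriv ^^ n) g x"
  using assms(3)
proof (induction n arbitrary: x)
  case (Suc n)
  have "eventually (\<lambda>y. (deriv ^^ n) f y = (deriv ^^ n) g y) (nhds x)"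
    using eventually_nhds_in_open[OF assms(1) Suc.prems] by eventually_elim (rule Suc.IH)
  then show ?case by (simp add: deriv_cong_ev)
qed (simp add: assms(2))

lemma deriv_funpow_cos:
  "(deriv ^^ n) (\<lambda>x. cos (w * x + t)) = (\<lambda>x. w ^ n * cos (w * x + t + real n * (pi / 2)))"
proof (induction n)
  case (Suc n)
  have "((\<lambda>x. w ^ n * cos (w * x + t + real n * (pi / 2))) has_real_derivative
      w ^ Suc n * cos (w * x + t + real (Suc n) * (pi / 2))) (at x)" for x
  proof -
    have "w * x + t + real (Suc n) * (pi / 2) = (w * x + t + real n * (pi / 2)) + pi / 2"
      by (simp add: field_simps)
    then have "cos (w * x + t + real (Suc n) * (pi / 2)) = - sin (w * x + t + real n * (pi / 2))"
      by (simp only: cos_add) simp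
    then show ?thesis by (auto intro!: derivative_eq_intros)
  qed
  then show ?case using Suc by (auto intro!: DERIV_imp_deriv)
qed simp

text \<open>Each of the r derivatives advances the phase by pi/2, which cancels the initial shift.
  Where the cutoff is constantly 1 it contributes nothing.\<close>

lemma deriv_funpow_plateau_cos:
  assumes "\<bar>x\<bar> < R"
  shows "(deriv ^^ r) (\<lambda>x. plateau R x * cos (w * x - real r * (pi / 2))) x = w ^ r * cos (w * x)"
proof -
  have "(deriv ^^ r) (\<lambda>x. plateau R x * cos (w * x - real r * (pi / 2))) x
      = (deriv ^^ r) (\<lambda>x. cos (w * x + (- (real r * (pi / 2))))) x"
    by (rule deriv_funpow_cong[of "{-R<..<R}"]) (use assms in \<open>auto simp: plateau_eq_1\<close>)
  then show ?thesis unfolding deriv_funpow_cos by simp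
qed

lemma integrable_tensor:
  assumes "integrable lborel F" "integrable lborel G"
  shows "integrable lborel (tensor F G)"
    and "(LINT x|lborel. tensor F G x) = (LINT x|lborel. F x) * (LINT x|lborel. G x)"
proof -
  have [measurable]: "F \<in> borel_measurable borel" "G \<in> borel_measurable borel" using assms by auto
  have i: "integrable (lborel \<Otimes>\<^sub>M lborel) (\<lambda>(x, y). F x * G y)"
  proof (rule lborel_pair.Fubini_integrable)
    show "integrable lborel (\<lambda>x. LINT y|lborel. norm (case (x, y) of (x, y) \<Rightarrow> F x * G y))"
      using assms by (simp add: abs_mult)
    show "AE x in lborel. integrable lborel (\<lambda>y. case (x, y) of (x, y) \<Rightarrow> F x * G y)"
      using assms by simp
  qed measurable
  then show "integrable lborel (tensor F G)" by (simp add: tensor_def lborel_prod)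
  show "(LINT x|lborel. tensor F G x) = (LINT x|lborel. F x) * (LINT x|lborel. G x)"
    using lborel_pair.integral_fst[OF i] by (simp add: tensor_def lborel_prod)
qed

lemma locally_integrable_UNIV_measurable:
  assumes "locally_integrable UNIV f"
  shows "f \<in> borel_measurable borel"
proof (rule borel_measurable_LIMSEQ_metric)
  fix n :: nat
  have "set_integrable lborel (cball 0 (real n)) f"
    using assms by (auto simp: locally_integrable_def)
  then show "(\<lambda>x. indicator (cball 0 (real n)) x *\<^sub>R f x) \<in> borel_measurable borel"
    by (auto simp: set_integrable_def dest: borel_measurable_integrable)
next
  fix x :: "real \<times> real"
  obtain N :: nat where "norm x \<le> real N" using real_arch_simple by blast
  then show "(\<lambda>n. indicator (cball 0 (real n)) x *\<^sub>R f x) \<longlonglongrightarrow> f x"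
    by (intro tendsto_eventually eventually_sequentiallyI[of N]) auto
qed

lemma locally_integrable_UNIV_integrable:
  assumes "locally_integrable UNIV f" "compact (ess_supp f)"
  shows "integrable lborel f"
proof -
  have i: "integrable lborel (\<lambda>x. indicator (ess_supp f) x *\<^sub>R f x)"
    using assms by (simp add: locally_integrable_def set_integrable_def)
  have ae: "AE x in lborel. indicator (ess_supp f) x *\<^sub>R f x = f x"
    using AE_eq_0_outside_ess_supp[of f] by eventually_elim (auto simp: indicator_def)
  have "f \<in> borel_measurable lborel" using locally_integrable_UNIV_measurable[OF assms(1)] by simp
  from integrable_cong_AE[OF borel_measurable_integrable[OF i] this ae] i show ?thesis by simp
qed

lemma integral_plateau_tendsto:
  assumes "integrable lborel \<psi>"
  shows "(\<lambda>n. LINT x|lborel. \<psi> x * (plateau (real n) x * cos (w * x - t)))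
    \<longlonglongrightarrow> (LINT x|lborel. \<psi> x * cos (w * x - t))"
proof (rule integral_dominated_convergence[where w = "\<lambda>x. \<bar>\<psi> x\<bar>"])
  have [measurable]: "\<psi> \<in> borel_measurable borel" "plateau R \<in> borel_measurable borel" for R
    using assms borel_measurable_continuous_onI[OF smooth1_continuous[OF smooth1_plateau]] by auto
  show "(\<lambda>x. \<psi> x * cos (w * x - t)) \<in> borel_measurable lborel"
    "(\<lambda>x. \<psi> x * (plateau (real n) x * cos (w * x - t))) \<in> borel_measurable lborel" for n
    by measurable
  show "integrable lborel (\<lambda>x. \<bar>\<psi> x\<bar>)" using assms by simp
  show "AE x in lborel. (\<lambda>n. \<psi> x * (plateau (real n) x * cos (w * x - t))) \<longlonglongrightarrow> \<psi> x * cos (w * x - t)"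
  proof (intro AE_I2 tendsto_eventually)
    fix x :: real
    obtain N :: nat where "\<bar>x\<bar> \<le> real N" using real_arch_simple by blast
    then show "\<forall>\<^sub>F n in sequentially. \<psi> x * (plateau (real n) x * cos (w * x - t)) = \<psi> x * cos (w * x - t)"
      by (intro eventually_sequentiallyI[of N]) (simp add: plateau_eq_1)
  qed
  have "\<bar>plateau (real n) x\<bar> * \<bar>cos (w * x - t)\<bar> \<le> 1" for n x
    by (intro mult_le_one plateau_bounds abs_cos_le_one abs_ge_zero)
  then show "AE x in lborel. norm (\<psi> x * (plateau (real n) x * cos (w * x - t))) \<le> \<bar>\<psi> x\<bar>" for n
    by (intro AE_I2) (simp add: abs_mult mult_left_le)
qed

text \<open>Testing the weak derivative against truncated trigonometric functions computes, at the
  frequency \<open>(w, w)\<close>, the cosine-cosine part of the Fourier transform of \<open>\<phi>\<close>; the phase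
  shifts are chosen such that \<open>\<partial>\<^sub>1\<^bsup>r\<^esup> \<partial>\<^sub>2\<^bsup>s\<^esup>\<close> turns them into pure cosines.\<close>

lemma weak_deriv_tensor_cos:
  assumes wd: "has_weak_deriv UNIV (r, s) \<phi> (tensor \<psi>\<^sub>1 \<psi>\<^sub>2)" and supp: "compact (ess_supp \<phi>)"
    and int: "integrable lborel \<psi>\<^sub>1" "integrable lborel \<psi>\<^sub>2"
  shows "w ^ (r + s) * (LINT x|lborel. \<phi> x * (cos (w * fst x) * cos (w * snd x)))
    = (-1) ^ (r + s) * ((LINT x|lborel. \<psi>\<^sub>1 x * cos (w * x - real r * (pi / 2)))
                       * (LINT x|lborel. \<psi>\<^sub>2 x * cos (w * x - real s * (pi / 2))))"
proof -
  define a where "a n r x = plateau (real n) x * cos (w * x - real r * (pi / 2))" for n :: nat and r :: nat and x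
  have sa: "smooth1 (a n r)" for n r
    using smooth1_mult[OF smooth1_plateau[of "real n"] smooth1_cos[of w "- (real r * (pi / 2))"]]
    by (simp add: a_def[abs_def])
  have a0: "a n r x = 0" if "real n + 1 \<le> \<bar>x\<bar>" for n r x
    using that by (simp add: a_def plateau_eq_0)
  have test: "test_function UNIV (tensor (a n r) (a n s))" for n
    unfolding test_function_def
  proof (intro conjI exI[of _ "cbox (- (real n + 1), - (real n + 1)) (real n + 1, real n + 1)"])
    show "\<forall>r'. C_class r' (tensor (a n r) (a n s))"
      using smooth2_tensor[OF sa sa] by (simp add: smooth2_def)
    show "\<forall>x. x \<notin> cbox (- (real n + 1), - (real n + 1)) (real n + 1, real n + 1) \<longrightarrow> tensor (a n r) (a n s) x = 0"
    proof (intro allI impI)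
      fix z assume "z \<notin> cbox (- (real n + 1), - (real n + 1)) (real n + 1, real n + 1)"
      then have "real n + 1 \<le> \<bar>fst z\<bar> \<or> real n + 1 \<le> \<bar>snd z\<bar>" by (cases z) auto
      then show "tensor (a n r) (a n s) z = 0" using a0 by (auto simp: tensor_def case_prod_beta)
    qed
  qed simp_all
  have [measurable]: "\<phi> \<in> borel_measurable borel"
    using wd locally_integrable_UNIV_measurable by (simp add: has_weak_deriv_def)
  have cos_m: "(\<lambda>x::real \<times> real. cos (w * fst x)) \<in> borel_measurable borel"
    "(\<lambda>x::real \<times> real. cos (w * snd x)) \<in> borel_measurable borel"
    by (intro borel_measurable_continuous_onI continuous_intros)+
  have int_a: "integrable lborel (\<lambda>x. \<psi> x * a n r x)" if "integrable lborel \<psi>" for \<psi> n r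
  proof (rule Bochner_Integration.integrable_bound[OF that])
    have "\<psi> \<in> borel_measurable borel" "a n r \<in> borel_measurable borel"
      using that borel_measurable_continuous_onI[OF smooth1_continuous[OF sa]] by auto
    then show "(\<lambda>x. \<psi> x * a n r x) \<in> borel_measurable lborel" by measurable
    have "\<bar>a n r x\<bar> \<le> 1" for x
      unfolding a_def abs_mult by (intro mult_le_one plateau_bounds abs_cos_le_one abs_ge_zero)
    then show "AE x in lborel. norm (\<psi> x * a n r x) \<le> norm (\<psi> x)"
      by (intro AE_I2) (simp add: abs_mult mult_left_le)
  qed
  have "(LINT x|lborel. \<phi> x * partial_deriv (r, s) (tensor (a n r) (a n s)) x)
      = (-1) ^ (r + s) * (LINT x|lborel. tensor \<psi>\<^sub>1 \<psi>\<^sub>2 x * tensor (a n r) (a n s) x)" for n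
    using wd test[of n] by (simp add: has_weak_deriv_def set_lebesgue_integral_def)
  moreover have "(\<lambda>x. tensor \<psi>\<^sub>1 \<psi>\<^sub>2 x * tensor (a n r) (a n s) x)
      = tensor (\<lambda>x. \<psi>\<^sub>1 x * a n r x) (\<lambda>x. \<psi>\<^sub>2 x * a n s x)" for n
    by (auto simp: tensor_def fun_eq_iff)
  ultimately have eq: "(LINT x|lborel. \<phi> x * partial_deriv (r, s) (tensor (a n r) (a n s)) x)
      = (-1) ^ (r + s) * ((LINT x|lborel. \<psi>\<^sub>1 x * a n r x) * (LINT x|lborel. \<psi>\<^sub>2 x * a n s x))" for n
    by (simp add: integrable_tensor(2) int_a int)
  \<comment> \<open>On this side only integrability of the two factors is available, so the cutoff
    disappears in the limit.\<close>
  have lim: "(\<lambda>n. LINT x|lborel. \<phi> x * partial_deriv (r, s) (tensor (a n r) (a n s)) x) \<longlonglongrightarrow>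
    (-1) ^ (r + s) * ((LINT x|lborel. \<psi>\<^sub>1 x * cos (w * x - real r * (pi / 2)))
                       * (LINT x|lborel. \<psi>\<^sub>2 x * cos (w * x - real s * (pi / 2))))"
    unfolding eq a_def by (intro tendsto_mult tendsto_const integral_plateau_tendsto int)
  obtain B where B: "\<And>x. x \<in> ess_supp \<phi> \<Longrightarrow> norm x \<le> B"
    using compact_imp_bounded[OF supp] unfolding bounded_iff by blast
  obtain N :: nat where N: "B < real N" using reals_Archimedean2 by blast
  \<comment> \<open>Once n exceeds the radius of the support of \<phi>, the cutoffs are 1 around it
    and the left side no longer depends on n. The limit identity is therefore an exact equation for
    every w.\<close>
  have ev: "(LINT x|lborel. \<phi> x * partial_deriv (r, s) (tensor (a n r) (a n s)) x)
      = w ^ (r + s) * (LINT x|lborel. \<phi> x * (cos (w * fst x) * cos (w * snd x)))" if n: "N \<le> n" for n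
  proof -
    have *: "partial_deriv (r, s) (tensor (a n r) (a n s)) x = w ^ (r + s) * (cos (w * fst x) * cos (w * snd x))"
      if "x \<in> ess_supp \<phi>" for x
    proof -
      have "\<bar>fst x\<bar> < real n" "\<bar>snd x\<bar> < real n"
        using B[OF that] N n norm_fst_le[of "fst x" "snd x"] norm_snd_le[of "snd x" "fst x"] by simp_all
      then show ?thesis
        using deriv_funpow_plateau_cos[of "fst x" "real n" r w] deriv_funpow_plateau_cos[of "snd x" "real n" s w]
        unfolding partial_deriv_tensor[OF sa sa] unfolding tensor_def case_prod_beta
        by (simp add: a_def[abs_def] power_add)
    qed
    have "partial_deriv (r, s) (tensor (a n r) (a n s)) \<in> borel_measurable borel"
      unfolding partial_deriv_tensor[OF sa sa]
      by (intro borel_measurable_continuous_onI smooth2_continuous smooth2_tensor smooth1_deriv_funpow sa)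
    then have "(LINT x|lborel. \<phi> x * partial_deriv (r, s) (tensor (a n r) (a n s)) x)
      = (LINT x|lborel. w ^ (r + s) * (\<phi> x * (cos (w * fst x) * cos (w * snd x))))"
    proof (intro integral_cong_AE)
      show "AE x in lborel. \<phi> x * partial_deriv (r, s) (tensor (a n r) (a n s)) x
          = w ^ (r + s) * (\<phi> x * (cos (w * fst x) * cos (w * snd x)))"
        using AE_eq_0_outside_ess_supp[of \<phi>] by eventually_elim (use * in auto)
    qed (auto intro!: borel_measurable_times cos_m)
    then show ?thesis by simp
  qed
  show ?thesis
    by (rule LIMSEQ_unique[OF _ lim], rule tendsto_eventually)
       (rule eventually_sequentiallyI[of N], rule ev)
qed

section \<open>Fourier transforms of univariate framelets\<close>

text \<open>The univariate framelet with filter \<open>h\<close>. The factor 2 is chosen so that a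
  tensor product of two of them carries the factor 4 of \<open>framelet\<close>.\<close>

definition wavelet1 :: "(int \<Rightarrow> real) \<Rightarrow> (real \<Rightarrow> real) \<Rightarrow> real \<Rightarrow> real" where
  "wavelet1 h B x = 2 * (\<Sum>k\<in>fsupp h. h k * B (2 * x - real_of_int k))"

lemma integrable_wavelet1: "integrable lborel B \<Longrightarrow> integrable lborel (wavelet1 h B)"
  unfolding wavelet1_def[abs_def]
  using lborel_integrable_real_affine[of B 2 "- real_of_int k" for k]
  by (auto intro!: Bochner_Integration.integrable_sum)

lemma integrable_of_real_times_cis:
  assumes "integrable lborel B"
  shows "integrable lborel (\<lambda>x. complex_of_real (B x) * cis (w * x + t))"
proof (rule Bochner_Integration.integrable_bound[OF assms])
  have [measurable]: "B \<in> borel_measurable borel" using assms by auto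
  have "(\<lambda>x. cis (w * x + t)) \<in> borel_measurable borel"
    by (intro borel_measurable_continuous_onI continuous_intros)
  then show "(\<lambda>x. complex_of_real (B x) * cis (w * x + t)) \<in> borel_measurable lborel" by measurable
qed (simp add: norm_mult)

text \<open>The transform of the two-scale relation: filter symbol times transform of
  \<open>B\<close>, both at w/2. The substitution y = 2x - k absorbs the factor 2.\<close>

lemma fourier_wavelet1:
  assumes "integrable lborel B"
  shows "(LINT x|lborel. complex_of_real (wavelet1 h B x) * cis (- (w * x)))
    = (\<Sum>k\<in>fsupp h. complex_of_real (h k) * cis (- (real_of_int k * (w / 2))))
      * (LINT x|lborel. complex_of_real (B x) * cis (- (w / 2 * x)))"
proof -
  let ?I = "LINT x|lborel. complex_of_real (B x) * cis (- (w / 2 * x))"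
  have tap: "2 * (LINT x|lborel. complex_of_real (B (2 * x - real_of_int k)) * cis (- (w * x)))
      = cis (- (real_of_int k * (w / 2))) * ?I" for k
  proof -
    let ?f = "\<lambda>y. complex_of_real (B y) * cis (- (w / 2 * (y + real_of_int k)))"
    have f: "?f (- real_of_int k + 2 * x) = complex_of_real (B (2 * x - real_of_int k)) * cis (- (w * x))" for x
      by (simp add: algebra_simps)
    have "(LINT y|lborel. ?f y) = \<bar>2\<bar> *\<^sub>R (LINT x|lborel. ?f (- real_of_int k + 2 * x))"
      by (rule lborel_integral_real_affine) simp
    then have "2 * (LINT x|lborel. complex_of_real (B (2 * x - real_of_int k)) * cis (- (w * x)))
        = (LINT y|lborel. ?f y)" unfolding f by (simp add: scaleR_conv_of_real)
    also have "?f = (\<lambda>y. cis (- (real_of_int k * (w / 2))) * (complex_of_real (B y) * cis (- (w / 2 * y))))"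
    proof
      fix y
      have "- (w / 2 * (y + real_of_int k)) = - (real_of_int k * (w / 2)) + - (w / 2 * y)"
        by (simp add: field_simps)
      then show "?f y = cis (- (real_of_int k * (w / 2))) * (complex_of_real (B y) * cis (- (w / 2 * y)))"
        by (simp only: cis_mult[symmetric] mult_ac)
    qed
    also have "(LINT y|lborel. \<dots> y) = cis (- (real_of_int k * (w / 2))) * ?I" by simp
    finally show ?thesis .
  qed
  have i: "integrable lborel (\<lambda>x. complex_of_real (B (2 * x - real_of_int k)) * cis (- (w * x)))" for k
    using integrable_of_real_times_cis[OF lborel_integrable_real_affine[OF assms, of 2 "- real_of_int k"], of "- w" 0]
    by simp
  have "(LINT x|lborel. complex_of_real (wavelet1 h B x) * cis (- (w * x)))
      = (LINT x|lborel. (\<Sum>k\<in>fsupp h. 2 * complex_of_real (h k) *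
          (complex_of_real (B (2 * x - real_of_int k)) * cis (- (w * x)))))"
    by (simp add: wavelet1_def sum_distrib_left sum_distrib_right mult.assoc)
  also have "\<dots> = (\<Sum>k\<in>fsupp h. 2 * complex_of_real (h k) *
      (LINT x|lborel. complex_of_real (B (2 * x - real_of_int k)) * cis (- (w * x))))"
    using i by (subst Bochner_Integration.integral_sum) auto
  also have "\<dots> = (\<Sum>k\<in>fsupp h. complex_of_real (h k) * (cis (- (real_of_int k * (w / 2))) * ?I))"
    unfolding tap[symmetric] by (simp only: mult.assoc mult.left_commute[of 2])
  finally show ?thesis by (simp add: sum_distrib_right mult.assoc)
qed

text \<open>The order of the zero at the origin comes from the factor sin(w/4)^r of the filter
  symbol; all other factors have nonzero limits.\<close>

lemma integral_wavelet1_cos_tendsto: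
  assumes B: "is_bspline m B" and h: "is_bspline_filter m r h" and r: "r \<le> m"
  shows "\<exists>c. c \<noteq> 0 \<and>
    ((\<lambda>w. (LINT x|lborel. wavelet1 h B x * cos (w * x - real r * (pi / 2))) / w ^ r) \<longlongrightarrow> c) (at 0)"
proof -
  obtain e :: real where e: "e \<in> {1, -1}" and
    H: "\<And>w. (\<Sum>k\<in>fsupp h. complex_of_real (h k) * cis (- (real_of_int k * w)))
        = complex_of_real e * \<i> ^ r * complex_of_real (sqrt (real (m choose r)))
          * cis (- (real (m mod 2) * w / 2))
          * complex_of_real (cos (w / 2) ^ (m - r) * sin (w / 2) ^ r)"
    using h unfolding is_bspline_filter_def by blast
  have iB: "integrable lborel B" using B by (simp add: is_bspline_def)
  have BF: "\<And>w. (LINT x|lborel. complex_of_real (B x) * cis (- (w * x)))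
        = cis (- (real (m mod 2) * w / 2)) * complex_of_real (sinc (w / 2) ^ m)"
    using B unfolding is_bspline_def by blast
  \<comment> \<open>The phase shift contributes \<i>^r, which meets the \<i>^r of the filter symbol
    to give the real sign (-1)^r. Taking the real part then leaves an explicit product.\<close>
  define c0 where "c0 = e * (-1) ^ r * sqrt (real (m choose r))"
  have val: "(LINT x|lborel. wavelet1 h B x * cos (w * x - real r * (pi / 2)))
      = c0 * cos (real (m mod 2) * w / 2) * cos (w / 4) ^ (m - r) * sinc (w / 4) ^ m * sin (w / 4) ^ r" for w
  proof -
    have ir: "cis (real r * (pi / 2)) = \<i> ^ r"
      using Complex.DeMoivre[of "pi / 2" r] unfolding cis_pi_half by (rule sym)
    have "(LINT x|lborel. wavelet1 h B x * cos (w * x - real r * (pi / 2)))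
        = (LINT x|lborel. Re (cis (real r * (pi / 2)) * (complex_of_real (wavelet1 h B x) * cis (- (w * x)))))"
      by (rule Bochner_Integration.integral_cong)
         (simp_all add: cos_diff algebra_simps)
    also have "\<dots> = Re (cis (real r * (pi / 2)) * (LINT x|lborel. complex_of_real (wavelet1 h B x) * cis (- (w * x))))"
      using integrable_of_real_times_cis[OF integrable_wavelet1[OF iB], of h "- w" 0]
      by (subst integral_Re) auto
    also have "(LINT x|lborel. complex_of_real (wavelet1 h B x) * cis (- (w * x)))
        = (complex_of_real e * \<i> ^ r * complex_of_real (sqrt (real (m choose r)))
          * cis (- (real (m mod 2) * (w / 2) / 2))
          * complex_of_real (cos (w / 2 / 2) ^ (m - r) * sin (w / 2 / 2) ^ r))
          * (cis (- (real (m mod 2) * (w / 2) / 2)) * complex_of_real (sinc (w / 2 / 2) ^ m))"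
      unfolding fourier_wavelet1[OF iB] H BF ..
    also have "cis (real r * (pi / 2)) * \<dots> = complex_of_real (c0 * (cos (w / 4) ^ (m - r) * sin (w / 4) ^ r * sinc (w / 4) ^ m))
        * cis (- (real (m mod 2) * w / 2))"
    proof -
      have "\<i> ^ r * \<i> ^ r = (-1) ^ r" by (simp flip: power_mult_distrib)
      moreover have "cis (- (real (m mod 2) * (w / 2) / 2)) * cis (- (real (m mod 2) * (w / 2) / 2))
          = cis (- (real (m mod 2) * w / 2))" by (simp add: cis_mult mult.commute)
      ultimately show ?thesis unfolding ir c0_def
        by (simp add: mult_ac)
    qed
    finally show ?thesis by simp
  qed
  define S where "S w = sin (w / 4) / w" for w :: real
  have cont: "isCont (\<lambda>w. sinc (w / 4)) 0"
    by (rule isCont_o2[of _ "\<lambda>w. w / 4", OF _ isCont_sinc]) simp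
  have sc: "((\<lambda>w. sinc (w / 4)) \<longlongrightarrow> 1) (at 0)"
    using cont unfolding isCont_def by simp
  have S: "(S \<longlongrightarrow> 1/4) (at 0)"
  proof (rule Lim_transform_eventually)
    show "((\<lambda>w. (1/4) * sinc (w / 4)) \<longlongrightarrow> 1/4) (at 0)"
      using tendsto_mult[OF tendsto_const sc, of "1/4"] by simp
    show "\<forall>\<^sub>F w in at 0. (1/4) * sinc (w / 4) = S w"
      by (auto simp: S_def eventually_at_filter)
  qed
  have "((\<lambda>w. c0 * cos (real (m mod 2) * w / 2) * cos (w / 4) ^ (m - r) * sinc (w / 4) ^ m * S w ^ r)
      \<longlongrightarrow> c0 * cos (real (m mod 2) * 0 / 2) * cos (0 / 4) ^ (m - r) * 1 ^ m * (1/4) ^ r) (at 0)"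
    by (intro tendsto_intros sc S) auto
  then have "((\<lambda>w. (LINT x|lborel. wavelet1 h B x * cos (w * x - real r * (pi / 2))) / w ^ r) \<longlongrightarrow> c0 * (1/4) ^ r) (at 0)"
    unfolding val S_def by (simp add: power_divide)
  moreover have "c0 \<noteq> 0" using e r by (auto simp: c0_def)
  ultimately show ?thesis by (intro exI[of _ "c0 * (1/4) ^ r"]) simp
qed

section \<open>Sampling is surjective\<close>

lemma bspline_integral:
  assumes "is_bspline m B"
  shows "(LINT x|lborel. B x) = 1"
proof -
  have "\<forall>w. (LINT x|lborel. complex_of_real (B x) * cis (- (w * x)))
        = cis (- (real (m mod 2) * w / 2)) * complex_of_real (sinc (w / 2) ^ m)"
    using assms unfolding is_bspline_def by blast
  from spec[OF this, of 0] have "(LINT x|lborel. complex_of_real (B x)) = 1" by simp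
  then show ?thesis by (simp add: integral_complex_of_real)
qed

lemma fsupp_tensor: "fsupp (tensor f g) = fsupp f \<times> fsupp g"
  by (auto simp: fsupp_def tensor_def)

text \<open>The sum over the taps factors because filter and scaling function are both tensor
  products. Index 0 is excluded since \<open>qfilt\<close> reserves it for the low-pass
  filter.\<close>

lemma framelet_eq_tensor:
  assumes "j \<noteq> 0"
  shows "framelet S j = tensor (wavelet1 (filt S (fst (exps S j))) (spline S))
                              (wavelet1 (filt S (snd (exps S j))) (spline S))"
proof
  fix x :: "real \<times> real"
  obtain a b where x: "x = (a, b)" by (cases x)
  let ?f = "filt S (fst (exps S j))" and ?g = "filt S (snd (exps S j))"
  have "qfilt S j = tensor ?f ?g" using assms by (simp add: qfilt_def)
  then have q: "fsupp (qfilt S j) = fsupp ?f \<times> fsupp ?g" "qfilt S j k = ?f (fst k) * ?g (snd k)" for k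
    by (simp_all add: fsupp_tensor) (simp add: tensor_def case_prod_beta)
  show "framelet S j x = tensor (wavelet1 ?f (spline S)) (wavelet1 ?g (spline S)) x"
    by (simp add: x framelet_def q scaling_fn_def wavelet1_def tensor_def
        lattice_pt_def sum_product sum.cartesian_product case_prod_beta mult_ac)
qed

text \<open>The weak equation gives w^(r+s) Q(w) as a signed product of two univariate integrals
  that vanish at 0 exactly to the orders r and s. After division Q has a nonzero limit at 0, and
  that limit is the mean, because the cosines in Q tend to 1.\<close>

lemma cst_nonzero:
  assumes S: "is_framelet_system S" and j: "j \<in> {1..num S}"
  shows "cst S j \<noteq> 0" "integrable lborel (prim S j)"
proof -
  let ?r = "fst (exps S j)" and ?s = "snd (exps S j)" and ?\<phi> = "prim S j"
  let ?\<psi> = "\<lambda>r. wavelet1 (filt S r) (spline S)"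
  have B: "is_bspline (spline_ord S) (spline S)" using S by (simp add: is_framelet_system_def)
  have iB: "integrable lborel (spline S)" using B by (simp add: is_bspline_def)
  have le: "?r \<le> spline_ord S" "?s \<le> spline_ord S"
    and supp: "compact (ess_supp ?\<phi>)"
    and wd: "has_weak_deriv UNIV (?r, ?s) ?\<phi> (framelet S j)"
    using S j by (auto simp: is_framelet_system_def)
  have fl: "is_bspline_filter (spline_ord S) r (filt S r)" if "r \<le> spline_ord S" for r
    using S that by (simp add: is_framelet_system_def)
  from wd show int: "integrable lborel ?\<phi>"
    by (intro locally_integrable_UNIV_integrable supp) (simp add: has_weak_deriv_def)
  define I where "I r w = (LINT x|lborel. ?\<psi> r x * cos (w * x - real r * (pi / 2)))" for r w
  define Q where "Q w = (LINT x|lborel. ?\<phi> x * (cos (w * fst x) * cos (w * snd x)))" for w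
  have wd': "has_weak_deriv UNIV (?r, ?s) ?\<phi> (tensor (?\<psi> ?r) (?\<psi> ?s))"
    using wd j by (simp add: framelet_eq_tensor)
  have Q: "Q w = (-1) ^ (?r + ?s) * ((I ?r w / w ^ ?r) * (I ?s w / w ^ ?s))" if "w \<noteq> 0" for w
  proof -
    have "w ^ (?r + ?s) * Q w = (-1) ^ (?r + ?s) * (I ?r w * I ?s w)"
      using weak_deriv_tensor_cos[OF wd' supp integrable_wavelet1[OF iB] integrable_wavelet1[OF iB]]
      unfolding Q_def I_def .
    then have "Q w = (-1) ^ (?r + ?s) * (I ?r w * I ?s w) / w ^ (?r + ?s)"
      using that by (metis nonzero_mult_div_cancel_left power_not_zero)
    then show ?thesis by (simp add: power_add)
  qed
  obtain c where c: "c \<noteq> 0" "((\<lambda>w. I ?r w / w ^ ?r) \<longlongrightarrow> c) (at 0)"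
    using integral_wavelet1_cos_tendsto[OF B fl[OF le(1)] le(1)] unfolding I_def by blast
  obtain d where d: "d \<noteq> 0" "((\<lambda>w. I ?s w / w ^ ?s) \<longlongrightarrow> d) (at 0)"
    using integral_wavelet1_cos_tendsto[OF B fl[OF le(2)] le(2)] unfolding I_def by blast
  have "((\<lambda>w. (-1) ^ (?r + ?s) * ((I ?r w / w ^ ?r) * (I ?s w / w ^ ?s))) \<longlongrightarrow> (-1) ^ (?r + ?s) * (c * d)) (at 0)"
    by (intro tendsto_mult tendsto_const c d)
  then have lim: "(Q \<longlongrightarrow> (-1) ^ (?r + ?s) * (c * d)) (at 0)"
    by (rule Lim_transform_eventually) (use Q in \<open>auto simp: eventually_at_filter\<close>)
  have "(\<lambda>n. Q (1 / real (Suc n))) \<longlonglongrightarrow> (LINT x|lborel. ?\<phi> x)"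
    unfolding Q_def
  proof (rule integral_dominated_convergence[where w = "\<lambda>x. \<bar>?\<phi> x\<bar>"])
    show "?\<phi> \<in> borel_measurable lborel" using int by auto
    have cos_m: "(\<lambda>x::real \<times> real. cos (w * fst x)) \<in> borel_measurable borel"
      "(\<lambda>x::real \<times> real. cos (w * snd x)) \<in> borel_measurable borel" for w
      by (intro borel_measurable_continuous_onI continuous_intros)+
    show "(\<lambda>x. ?\<phi> x * (cos (1 / real (Suc n) * fst x) * cos (1 / real (Suc n) * snd x)))
        \<in> borel_measurable lborel" for n
      using borel_measurable_integrable[OF int]
      by (intro borel_measurable_times) (simp_all only: measurable_lborel2 cos_m)
    show "integrable lborel (\<lambda>x. \<bar>?\<phi> x\<bar>)" using int by simp
    show "AE x in lborel. (\<lambda>n. ?\<phi> x * (cos (1 / real (Suc n) * fst x) * cos (1 / real (Suc n) * snd x)))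
        \<longlonglongrightarrow> ?\<phi> x"
    proof (rule AE_I2)
      fix x :: "real \<times> real"
      have "(\<lambda>n. ?\<phi> x * (cos (1 / real (Suc n) * fst x) * cos (1 / real (Suc n) * snd x)))
          \<longlonglongrightarrow> ?\<phi> x * (cos (0 * fst x) * cos (0 * snd x))"
        by (intro tendsto_mult tendsto_const tendsto_cos LIMSEQ_Suc[OF lim_1_over_n])
      then show "(\<lambda>n. ?\<phi> x * (cos (1 / real (Suc n) * fst x) * cos (1 / real (Suc n) * snd x)))
          \<longlonglongrightarrow> ?\<phi> x" by simp
    qed
    have "\<bar>cos a\<bar> * \<bar>cos b\<bar> \<le> 1" for a b :: real
      by (intro mult_le_one abs_cos_le_one abs_ge_zero)
    then show "AE x in lborel. norm (?\<phi> x * (cos (1 / real (Suc n) * fst x) * cos (1 / real (Suc n) * snd x)))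
        \<le> \<bar>?\<phi> x\<bar>" for n
      by (intro AE_I2) (simp add: abs_mult mult_left_le del: of_nat_Suc)
  qed
  moreover have "(\<lambda>n. Q (1 / real (Suc n))) \<longlonglongrightarrow> (-1) ^ (?r + ?s) * (c * d)"
    using LIMSEQ_Suc[OF lim_1_over_n] by (intro filterlim_compose[OF lim]) (auto simp: filterlim_at)
  ultimately have "cst S j = (-1) ^ (?r + ?s) * (c * d)"
    unfolding cst_def by (rule LIMSEQ_unique)
  then show "cst S j \<noteq> 0" using c d by simp
qed

lemma ess_supp_nonempty: "(LINT x|lborel. f x) \<noteq> 0 \<Longrightarrow> ess_supp f \<noteq> {}"
  using AE_eq_0_outside_ess_supp[of f] integral_eq_zero_AE[of f lborel] by auto

section \<open>Supports of the scaling functions and size of the index sets\<close>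

lemma scaling_fn_properties:
  assumes "is_framelet_system S"
  shows "integrable lborel (scaling_fn S)" "ess_supp (scaling_fn S) \<noteq> {}"
proof -
  have B: "is_bspline (spline_ord S) (spline S)" using assms by (simp add: is_framelet_system_def)
  then have i: "integrable lborel (spline S)" by (simp add: is_bspline_def)
  show "integrable lborel (scaling_fn S)" unfolding scaling_fn_def by (intro integrable_tensor i)
  show "ess_supp (scaling_fn S) \<noteq> {}"
    by (rule ess_supp_nonempty) (simp add: scaling_fn_def integrable_tensor i bspline_integral[OF B])
qed

lemma ess_supp_scaled_phi:
  assumes "is_framelet_system S"
  shows "x \<in> ess_supp (scaled_phi S n k) \<longleftrightarrow> 2 ^ n *\<^sub>R x - lattice_pt k \<in> ess_supp (scaling_fn S)"
  unfolding scaled_phi_def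
  using scaling_fn_properties(1)[OF assms] by (intro ess_supp_affine) (auto dest: borel_measurable_integrable)

lemma Mset_support:
  assumes "is_framelet_system S" "k \<in> Mset S n" "y \<in> ess_supp (scaling_fn S)"
  shows "(1 / 2 ^ n) *\<^sub>R (y + lattice_pt k) \<in> cbox (0, 0) (1, 1)"
proof -
  have "(1 / 2 ^ n) *\<^sub>R (y + lattice_pt k) \<in> ess_supp (scaled_phi S n k)"
    using assms by (simp add: ess_supp_scaled_phi)
  then show ?thesis using assms(2) unfolding Mset_def closure_unit_square by blast
qed

text \<open>A single point y of the support of the scaling function is enough: its translates and
  dilates must lie in the closed square, which confines k to a finite box.\<close>

lemma finite_Kset:
  assumes "is_framelet_system S"
  shows "finite (Kset S C n)"
proof -
  obtain y where y: "y \<in> ess_supp (scaling_fn S)" using scaling_fn_properties(2)[OF assms] by blast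
  obtain a b where ab: "y = (a, b)" by (cases y)
  have "Mset S n \<subseteq> {\<lceil>- a\<rceil>..\<lfloor>2 ^ n - a\<rfloor>} \<times> {\<lceil>- b\<rceil>..\<lfloor>2 ^ n - b\<rfloor>}"
  proof
    fix k assume "k \<in> Mset S n"
    from Mset_support[OF assms this y]
    have "0 \<le> a + fst k" "a + fst k \<le> 2 ^ n" "0 \<le> b + snd k" "b + snd k \<le> 2 ^ n"
      by (auto simp: ab lattice_pt_def field_simps)
    then show "k \<in> {\<lceil>- a\<rceil>..\<lfloor>2 ^ n - a\<rfloor>} \<times> {\<lceil>- b\<rceil>..\<lfloor>2 ^ n - b\<rfloor>}"
      by (cases k) (auto simp: le_floor_iff ceiling_le_iff)
  qed
  then have "finite (Mset S n)" by (rule finite_subset) simp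
  moreover have "Kset S C n \<subseteq> Mset S n" by (auto simp: Kset_def)
  ultimately show ?thesis by (rule rev_finite_subset)
qed

text \<open>The spline is specified by its Fourier transform, so boundedness of its support is not
  immediate. It follows from any one index \<open>k\<close>: a dilated translate of the support fits
  into the closed square.\<close>

lemma compact_ess_supp_scaling_fn:
  assumes "is_framelet_system S" "k \<in> Mset S n"
  shows "compact (ess_supp (scaling_fn S))"
proof -
  have "ess_supp (scaling_fn S) \<subseteq> (\<lambda>x. 2 ^ n *\<^sub>R x - lattice_pt k) ` cbox (0, 0) (1, 1)"
    (is "_ \<subseteq> ?f ` _")
  proof
    fix y assume "y \<in> ess_supp (scaling_fn S)"
    from Mset_support[OF assms this] show "y \<in> ?f ` cbox (0, 0) (1, 1)"
      by (rule rev_image_eqI) simp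
  qed
  moreover have "compact (?f ` cbox (0, 0) (1, 1))"
    by (intro compact_continuous_image continuous_intros compact_cbox)
  ultimately show ?thesis
    using closed_ess_supp compact_imp_bounded bounded_subset unfolding compact_eq_bounded_closed by blast
qed

lemma sampleT_surjective:
  assumes "is_framelet_system S" "0 < p" "un \<in> arrays (Kset S C n)"
  shows "\<exists>u \<in> sobolev r p unit_square. sampleT S C n u = un"
proof -
  define P where "P u \<longleftrightarrow> smooth2 u \<and> (\<forall>k\<in>Kset S C n.
      (LINT x:unit_square|lborel. u x * (2 ^ n * scaling_fn S (2 ^ n *\<^sub>R x - 1 *\<^sub>R lattice_pt k))) = un k / 2 ^ n)" for u
  have "\<exists>u. P u"
  \<comment> \<open>Compactness of the support was obtained from an element of \<open>Mset\<close>;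
    without indices there is nothing to interpolate and any smooth function will do.\<close>
  proof (cases "Kset S C n = {}")
    case True
    then show ?thesis using smooth2_tensor[OF smooth1_flat_exp smooth1_flat_exp] by (auto simp: P_def)
  next
    case False
    then obtain k where "k \<in> Mset S n" by (auto simp: Kset_def)
    then show ?thesis unfolding P_def
      by (intro translates_interpolate finite_Kset scaling_fn_properties compact_ess_supp_scaling_fn[of S k n] assms(1))
         (auto simp: Kset_def Mset_def scaled_phi_def)
  qed
  then obtain u where u: "P u" by blast
  have "sampleT S C n u k = un k" for k
  proof (cases "k \<in> Kset S C n")
    case True
    then show ?thesis using u by (simp add: P_def sampleT_def scaled_phi_def)
  next
    \<comment> \<open>Arrays are extensional, so off the index set both sides have the default value
      \<open>undefined\<close>.\<close>
    case False
    then show ?thesis using PiE_arb[OF assms(3) False] by (simp add: sampleT_def)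
  qed
  moreover have "u \<in> sobolev r p unit_square"
    using u assms(2) by (intro smooth2_in_sobolev) (simp_all add: P_def unit_square_eq_box)
  ultimately show ?thesis by (intro bexI[of _ u] ext)
qed

lemma sampleS_surjective:
  assumes S: "is_framelet_system S" and "large_enough S C n" and q: "0 < q"
    and vn: "vn \<in> arrays ({1..num S} \<times> Kset S C n)"
  shows "\<exists>v \<in> sobolev_vec (num S) r q unit_square. sampleS S C n v = vn"
proof -
  \<comment> \<open>Each component is a separate interpolation problem, with half-integer
    translates. The factor \<open>cst S j / 2 ^ n\<close> in the target undoes the normalisation
    built into \<open>sampleS\<close>, which is possible since the mean is nonzero.\<close>
  define P where "P j u \<longleftrightarrow> smooth2 u \<and> (\<forall>k\<in>Kset S C n. (LINT x:unit_square|lborel. u x * (2 powi (int n - 2) *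
      prim S j (2 powi (int n - 1) *\<^sub>R x - (1 / 2) *\<^sub>R lattice_pt k))) = vn (j, k) * cst S j / 2 ^ n)" for j u
  have "\<forall>j\<in>{1..num S}. \<exists>u. P j u" unfolding P_def
  proof (intro ballI)
    fix j assume j: "j \<in> {1..num S}"
    show "\<exists>u. smooth2 u \<and> (\<forall>k\<in>Kset S C n. (LINT x:unit_square|lborel. u x * (2 powi (int n - 2) *
      prim S j (2 powi (int n - 1) *\<^sub>R x - (1 / 2) *\<^sub>R lattice_pt k))) = vn (j, k) * cst S j / 2 ^ n)"
    proof (rule translates_interpolate)
      show "finite (Kset S C n)" using S by (rule finite_Kset)
      show "integrable lborel (prim S j)" using S j by (rule cst_nonzero)
      show "compact (ess_supp (prim S j))" using S j by (auto simp: is_framelet_system_def)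
      show "ess_supp (prim S j) \<noteq> {}"
        using cst_nonzero(1)[OF S j] unfolding cst_def by (rule ess_supp_nonempty)
      fix k assume "k \<in> Kset S C n"
      then show "ess_supp (\<lambda>x. 2 powi (int n - 2) * prim S j (2 powi (int n - 1) *\<^sub>R x - (1 / 2) *\<^sub>R lattice_pt k))
          \<subseteq> closure unit_square"
        using assms(2) j unfolding large_enough_def scaled_prim_def by blast
    qed simp_all
  qed
  from bchoice[OF this] obtain v where v: "\<forall>j\<in>{1..num S}. P j (v j)" by blast
  have "sampleS S C n v (j, k) = vn (j, k)" for j k
  proof (cases "(j, k) \<in> {1..num S} \<times> Kset S C n")
    case True
    then have jk: "j \<in> {1..num S}" "k \<in> Kset S C n" by auto
    have "(LINT x:unit_square|lborel. v j x * (inverse (cst S j) * scaled_prim S j n k x))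
      = (LINT x:unit_square|lborel. inverse (cst S j) * (v j x * scaled_prim S j n k x))"
      by (simp only: mult.left_commute)
    also have "\<dots> = inverse (cst S j) * (vn (j, k) * cst S j / 2 ^ n)"
      using v jk by (simp add: P_def scaled_prim_def)
    finally show ?thesis using True cst_nonzero(1)[OF S jk(1)] by (simp add: sampleS_def)
  next
    case False
    then show ?thesis using PiE_arb[OF vn False] by (auto simp: sampleS_def)
  qed
  then have "sampleS S C n v = vn" by auto
  moreover have "v \<in> sobolev_vec (num S) r q unit_square"
    unfolding sobolev_vec_def using v q
    by (auto intro!: smooth2_in_sobolev simp: P_def unit_square_eq_box)
  ultimately show ?thesis by blast
qed

theorem proposition3p1:
  fixes S :: framelet_system and C :: int and n :: nat
    and p q \<nu>\<^sub>1 \<nu>\<^sub>2 :: real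
    and f :: "real \<times> real \<Rightarrow> real"
    and bc A :: "(int \<times> int \<Rightarrow> real) \<Rightarrow> int \<times> int \<Rightarrow> real"
  defines "K \<equiv> Kset S C n"
    and "U \<equiv> sobolev (2 * max_ord S) p unit_square"
    and "V \<equiv> sobolev_vec (num S) (max_ord S) q unit_square"
    and "F \<equiv> F_energy S C n bc A p q \<nu>\<^sub>1 \<nu>\<^sub>2 f"
    and "E \<equiv> E_energy S C n bc A p q \<nu>\<^sub>1 \<nu>\<^sub>2 f"
  assumes "is_framelet_system S"
    and "0 < C" and "large_enough S C n"
    and "boundary_extension K bc"
    and "array_linear K K A"
    and "1 \<le> p" "p \<le> 2" "1 \<le> q" "q \<le> 2"
    and "0 < \<nu>\<^sub>1" "0 < \<nu>\<^sub>2"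
    and "f \<in> Lp_on 2 unit_square"
  shows "(\<forall>un \<in> arrays K. \<forall>vn \<in> arrays ({1..num S} \<times> K).
            \<exists>u \<in> U. \<exists>v \<in> V. E u v = F un vn)
       \<and> (\<forall>u \<in> U. \<forall>v \<in> V.
            \<exists>un \<in> arrays K. \<exists>vn \<in> arrays ({1..num S} \<times> K). E u v = F un vn)
       \<and> (INF (un, vn) \<in> arrays K \<times> arrays ({1..num S} \<times> K). F un vn)
           = (INF (u, v) \<in> U \<times> V. E u v)"
proof -
  have E: "E u v = F (sampleT S C n u) (sampleS S C n v)" for u v
    by (simp add: E_def F_def E_energy_def)
  have 1: "\<exists>u \<in> U. \<exists>v \<in> V. E u v = F un vn"
    if uvn: "un \<in> arrays K" "vn \<in> arrays ({1..num S} \<times> K)" for un vn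
  proof -
    have "0 < p" "0 < q" using \<open>1 \<le> p\<close> \<open>1 \<le> q\<close> by auto
    obtain u where "u \<in> U" "sampleT S C n u = un"
      using sampleT_surjective[OF \<open>is_framelet_system S\<close> \<open>0 < p\<close> uvn(1)[unfolded K_def]]
      unfolding U_def by blast
    moreover obtain v where "v \<in> V" "sampleS S C n v = vn"
      using sampleS_surjective[OF \<open>is_framelet_system S\<close> \<open>large_enough S C n\<close> \<open>0 < q\<close> uvn(2)[unfolded K_def]]
      unfolding V_def by blast
    ultimately show ?thesis using E by blast
  qed
  have 2: "\<exists>un \<in> arrays K. \<exists>vn \<in> arrays ({1..num S} \<times> K). E u v = F un vn" for u v
  proof (intro bexI)
    show "E u v = F (sampleT S C n u) (sampleS S C n v)" by (rule E)
    show "sampleS S C n v \<in> arrays ({1..num S} \<times> K)"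
      unfolding sampleS_def K_def by (rule restrict_PiE_iff[THEN iffD2]) simp
    show "sampleT S C n u \<in> arrays K"
      unfolding sampleT_def K_def by (rule restrict_PiE_iff[THEN iffD2]) simp
  qed
  \<comment> \<open>The two infima are taken over the same set of real numbers, so their equality
    requires no discussion of bounds or minimisers.\<close>
  have "(\<lambda>(un, vn). F un vn) ` (arrays K \<times> arrays ({1..num S} \<times> K)) = (\<lambda>(u, v). E u v) ` (U \<times> V)"
    (is "?L = ?R")
  proof
    show "?L \<subseteq> ?R"
    proof clarify
      fix un vn assume "un \<in> arrays K" "vn \<in> arrays ({1..num S} \<times> K)"
      from 1[OF this] obtain u v where "u \<in> U" "v \<in> V" "F un vn = E u v" by metis
      then show "F un vn \<in> ?R" by force
    qed
    show "?R \<subseteq> ?L"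
    proof clarify
      fix u v
      from 2[of u v] obtain un vn where "un \<in> arrays K" "vn \<in> arrays ({1..num S} \<times> K)" "E u v = F un vn"
        by metis
      then show "E u v \<in> ?L" by force
    qed
  qed
  then show ?thesis using 1 2 by simp
qed

end
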